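(* Let $\mathbb{P}$ be the Prüfer surface (the double of the bordered Prüfer surface with ray families attached at all points of the $x$-axis $\mathbb{R}$), and let $\mathbb{R}^{\times}:=\mathbb{R}\setminus\{0\}$. Identify $\pi_1(\mathbb{P})$ with the free group on $\mathbb{R}^\times$ via the generators $[\alpha_{0,t}]$, $t\in\mathbb{R}^{\times}$, and hence $\mathrm{Hom}(\pi_1(\mathbb{P}),\mathbb{Z})$ with the group $\mathbb{Z}^{\mathbb{R}^{\times}}$ of all functions $\mathbb{R}^{\times}\to\mathbb{Z}$. Then the comparison morphism $\mathrm{comp}:\pi^1(\mathbb{P})\to \mathrm{Hom}(\pi_1(\mathbb{P}),\mathbb{Z})\cong \mathbb{Z}^{\mathbb{R}^{\times}}$ is injective and its image is precisely the additive group of Baire-1 functions $\mathbb{R}^{\times}\to\mathbb{Z}$.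
   Context: **Prüfer surface.** Let $\mathbb{H}_{++}=\{(x,y)\in\mathbb{R}^2 : y>0\}$ with its usual topology. For $p\in\mathbb{R}\cong\{(x,0)\}$ let $\mathcal{R}_p$ be the set of rays with origin $p=(p,0)$ which, apart from the origin, lie entirely in $\mathbb{H}_{++}$, topologized by angle (so $\mathcal{R}_p\cong\mathbb{R}$). As a set, $\mathbb{P}_\partial:=\mathbb{H}_{++}\sqcup\coprod_{p\in\mathbb{R}}\mathcal{R}_p$. The set $\mathbb{H}_{++}$ is open in $\mathbb{P}_\partial$ with its usual topology, and a neighborhood basis at $r\in\mathcal{R}_p$ is given by the sets (for $\varepsilon>0$) consisting of all rays in $\mathcal{R}_p$ at angle $<\varepsilon$ from $r$ together with all $x\in\mathbb{H}_{++}$ with $|x-p|<\varepsilon$ such that the ray $\overrightarrow{px}$ makes an angle $<\varepsilon$ with $r$. Thus a net in $\mathbb{H}_{++}$ converges to $r\in\mathcal{R}_p$ iff it converges to $p$ in the plane and the rays from $p$ through its members converge to $r$. $\mathbb{P}_\partial$ is a 2-manifold with boundary $\coprod_{p}\mathcal{R}_p$, and $\mathbb{P}$ is its double, i.e. two copies of $\mathbb{P}_\partial$ glued along the boundary by the identity. **Loops.** For $t\in\mathbb{R}^\times$, $\alpha_{0,t}$ is the loop in $\mathbb{P}$ based at the vertical ray at $0$ which first goes, in the first copy of $\mathbb{P}_\partial$, from the vertical ray at $0$ to the vertical ray at $t$ along the semicircle in the upper half-plane having the segment from $0$ to $t$ as diameter, and then returns along the reversal of the same semicircle in the second copy. It is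 known that $\pi_1(\mathbb{P})$ is free on the classes of $\alpha_{0,t}$, $t\in\mathbb{R}^\times$. **Cohomotopy.** For a space $X$, $\pi^1(X):=[X,\mathbb{S}^1]$ is the group (under pointwise multiplication in $\mathbb{S}^1$) of free homotopy classes of continuous maps $X\to\mathbb{S}^1$. For path-connected $X$, $\mathrm{comp}:\pi^1(X)\to\mathrm{Hom}(\pi_1(X),\mathbb{Z})$ sends $[g]$ to $g_*:\pi_1(X)\to\pi_1(\mathbb{S}^1)\cong\mathbb{Z}$. Under the identifications in the claim, $\mathrm{comp}([g])$ is the function $t\mapsto \deg(g\circ\alpha_{0,t})$. **Baire-1.** A function between metrizable spaces is Baire-1 if the preimage of every open set is $F_\sigma$ (a countable union of closed sets). Here $\mathbb{Z}$ is discrete and $\mathbb{R}^\times$ has its usual topology. *)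

theory Defs
  imports
    "HOL-Complex_Analysis.Winding_Numbers"
    "HOL-Algebra.Elementary_Groups"
    "HOL-Algebra.Product_Groups"
begin

section \<open>The bordered Pruefer surface\<close>

text \<open>
  The plane is \<^typ>\<open>complex\<close>. The ray with origin \<open>p\<close> on the real axis enclosing the angle
  \<open>\<theta>\<close> with the positive real direction is encoded as \<open>Ray p \<theta>\<close>; it lies in the open upper
  half-plane, apart from its origin, iff \<open>0 < \<theta> < pi\<close>.
\<close>

datatype bordered_point = Pt complex | Ray real real

definition boundary_rays :: "bordered_point set" where
  "boundary_rays = {Ray p \<theta> | p \<theta>. 0 < \<theta> \<and> \<theta> < pi}"

definition bordered_points :: "bordered_point set" where
  "bordered_points = {Pt z | z. Im z > 0} \<union> boundary_rays"

text \<open>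
  For \<open>z\<close> in the open upper half-plane, the ray from \<open>p\<close> through \<open>z\<close> has direction
  \<open>Arg (z - p) \<in> {0<..<pi}\<close>, so its angle with \<open>Ray p \<theta>\<close> is the absolute difference below.
\<close>

definition ray_nhd :: "real \<Rightarrow> real \<Rightarrow> real \<Rightarrow> bordered_point set" where
  "ray_nhd p \<theta> \<epsilon> =
     {Ray p \<phi> | \<phi>. 0 < \<phi> \<and> \<phi> < pi \<and> \<bar>\<phi> - \<theta>\<bar> < \<epsilon>} \<union>
     {Pt z | z. Im z > 0 \<and> cmod (z - of_real p) < \<epsilon> \<and> \<bar>Arg (z - of_real p) - \<theta>\<bar> < \<epsilon>}"

definition bordered_open :: "bordered_point set \<Rightarrow> bool" where
  "bordered_open U \<longleftrightarrow> U \<subseteq> bordered_points \<and> open {z. Pt z \<in> U} \<and>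
     (\<forall>p \<theta>. Ray p \<theta> \<in> U \<longrightarrow> (\<exists>\<epsilon>>0. ray_nhd p \<theta> \<epsilon> \<subseteq> U))"

definition bordered_prufer :: "bordered_point topology" where
  "bordered_prufer = topology bordered_open"

lemma ray_nhd_mono: "\<epsilon> \<le> \<delta> \<Longrightarrow> ray_nhd p \<theta> \<epsilon> \<subseteq> ray_nhd p \<theta> \<delta>"
  unfolding ray_nhd_def by fastforce

lemma istopology_bordered_open: "istopology bordered_open"
  unfolding istopology_def
proof (intro conjI allI impI)
  fix S T assume S: "bordered_open S" and T: "bordered_open T"
  have "{z. Pt z \<in> S \<inter> T} = {z. Pt z \<in> S} \<inter> {z. Pt z \<in> T}" by auto
  then have 1: "open {z. Pt z \<in> S \<inter> T}"
    using S T by (simp add: bordered_open_def open_Int)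
  have 2: "\<exists>\<epsilon>>0. ray_nhd p \<theta> \<epsilon> \<subseteq> S \<inter> T" if "Ray p \<theta> \<in> S \<inter> T" for p \<theta>
  proof -
    obtain a where a: "a > 0" "ray_nhd p \<theta> a \<subseteq> S"
      using S \<open>Ray p \<theta> \<in> S \<inter> T\<close> unfolding bordered_open_def by blast
    obtain b where b: "b > 0" "ray_nhd p \<theta> b \<subseteq> T"
      using T \<open>Ray p \<theta> \<in> S \<inter> T\<close> unfolding bordered_open_def by blast
    have "ray_nhd p \<theta> (min a b) \<subseteq> S \<inter> T"
      using a b ray_nhd_mono[of "min a b" a p \<theta>] ray_nhd_mono[of "min a b" b p \<theta>] by auto
    moreover have "min a b > 0" using a b by simp
    ultimately show ?thesis by blast
  qed
  show "bordered_open (S \<inter> T)"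
    using S 1 2 unfolding bordered_open_def by blast
next
  fix K assume K: "\<forall>U\<in>K. bordered_open U"
  have "{z. Pt z \<in> \<Union>K} = (\<Union>U\<in>K. {z. Pt z \<in> U})" by auto
  then have 1: "open {z. Pt z \<in> \<Union>K}"
    using K by (auto simp: bordered_open_def intro!: open_UN)
  have 2: "\<exists>\<epsilon>>0. ray_nhd p \<theta> \<epsilon> \<subseteq> \<Union>K" if ray: "Ray p \<theta> \<in> \<Union>K" for p \<theta>
  proof -
    obtain U where U: "U \<in> K" "Ray p \<theta> \<in> U" using ray by blast
    then obtain \<epsilon> where "\<epsilon> > 0" "ray_nhd p \<theta> \<epsilon> \<subseteq> U"
      using K unfolding bordered_open_def by blast
    then show ?thesis using U by blast
  qed
  show "bordered_open (\<Union>K)"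
    using K 1 2 unfolding bordered_open_def by blast
qed

lemma openin_bordered_prufer: "openin bordered_prufer U \<longleftrightarrow> bordered_open U"
  by (simp add: bordered_prufer_def istopology_bordered_open topology_inverse')

lemma topspace_bordered_prufer: "topspace bordered_prufer = bordered_points"
proof -
  have "{z. Pt z \<in> bordered_points} = {z. Im z > 0}"
    by (auto simp: bordered_points_def boundary_rays_def)
  then have "open {z. Pt z \<in> bordered_points}"
    by (simp add: open_halfspace_Im_gt)
  moreover have "ray_nhd p \<theta> 1 \<subseteq> bordered_points" for p \<theta>
    by (auto simp: ray_nhd_def bordered_points_def boundary_rays_def)
  ultimately have "bordered_open bordered_points"
    unfolding bordered_open_def by (meson order_refl zero_less_one)
  then show ?thesis
    unfolding topspace_def openin_bordered_prufer bordered_open_def by blast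
qed


section \<open>Doubles and the Pruefer surface\<close>

text \<open>
  Two copies of \<open>X\<close>, labelled \<open>False\<close> (first) and \<open>True\<close> (second), glued along \<open>A\<close> by the
  identity: \<open>glue A b\<close> is the embedding of copy \<open>b\<close>, points of \<open>A\<close> always get the label
  \<open>False\<close>, and the double carries the quotient topology.
\<close>

definition glue :: "'a set \<Rightarrow> bool \<Rightarrow> 'a \<Rightarrow> 'a \<times> bool" where
  "glue A b x = (x, b \<and> x \<notin> A)"

definition double_open :: "'a topology \<Rightarrow> 'a set \<Rightarrow> ('a \<times> bool) set \<Rightarrow> bool" where
  "double_open X A U \<longleftrightarrow> U \<subseteq> (\<Union>b. glue A b ` topspace X) \<and>
     (\<forall>b. openin X {x \<in> topspace X. glue A b x \<in> U})"

definition double_topology :: "'a topology \<Rightarrow> 'a set \<Rightarrow> ('a \<times> bool) topology" where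
  "double_topology X A = topology (double_open X A)"

lemma istopology_double_open: "istopology (double_open X A)"
  unfolding istopology_def
proof (intro conjI allI impI)
  fix S T assume S: "double_open X A S" and T: "double_open X A T"
  have "{x \<in> topspace X. glue A b x \<in> S \<inter> T} =
        {x \<in> topspace X. glue A b x \<in> S} \<inter> {x \<in> topspace X. glue A b x \<in> T}" for b
    by auto
  then show "double_open X A (S \<inter> T)"
    using S T unfolding double_open_def by (metis (no_types, lifting) inf.coboundedI1 openin_Int)
next
  fix K assume K: "\<forall>U\<in>K. double_open X A U"
  have "{x \<in> topspace X. glue A b x \<in> \<Union>K} =
        \<Union>((\<lambda>U. {x \<in> topspace X. glue A b x \<in> U}) ` K)" for b
    by auto
  moreover have "openin X (\<Union>((\<lambda>U. {x \<in> topspace X. glue A b x \<in> U}) ` K))" for b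
    using K unfolding double_open_def by (intro openin_Union) auto
  ultimately show "double_open X A (\<Union>K)"
    using K unfolding double_open_def by (simp add: Sup_le_iff)
qed

lemma openin_double_topology: "openin (double_topology X A) U \<longleftrightarrow> double_open X A U"
  by (simp add: double_topology_def istopology_double_open topology_inverse')

lemma topspace_double_topology:
  "topspace (double_topology X A) = (\<Union>b. glue A b ` topspace X)"
proof -
  have "{x \<in> topspace X. glue A b x \<in> (\<Union>b. glue A b ` topspace X)} = topspace X" for b
    by blast
  then have "double_open X A (\<Union>b. glue A b ` topspace X)"
    unfolding double_open_def by simp
  then show ?thesis
    unfolding topspace_def openin_double_topology double_open_def by blast
qed

definition prufer :: "(bordered_point \<times> bool) topology" where
  "prufer = double_topology bordered_prufer boundary_rays"


section \<open>Fundamental group\<close>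

definition path_join :: "(real \<Rightarrow> 'a) \<Rightarrow> (real \<Rightarrow> 'a) \<Rightarrow> real \<Rightarrow> 'a" where
  "path_join p q = (\<lambda>s. if s \<le> 1/2 then p (2 * s) else q (2 * s - 1))"

definition loops_at :: "'a topology \<Rightarrow> 'a \<Rightarrow> (real \<Rightarrow> 'a) set" where
  "loops_at X x = {\<gamma>. pathin X \<gamma> \<and> \<gamma> 0 = x \<and> \<gamma> 1 = x}"

text \<open>
  As \<^const>\<open>homotopic_with\<close> only constrains functions on the topological spaces involved, a
  class contains a path together with all functions that agree with it on \<open>{0..1}\<close>.
\<close>

definition path_class :: "'a topology \<Rightarrow> (real \<Rightarrow> 'a) \<Rightarrow> (real \<Rightarrow> 'a) set" where
  "path_class X p =
     {q. homotopic_with (\<lambda>r. r 0 = p 0 \<and> r 1 = p 1) (top_of_set {0..1}) X p q}"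

definition fundamental_group :: "'a topology \<Rightarrow> 'a \<Rightarrow> (real \<Rightarrow> 'a) set monoid" where
  "fundamental_group X x =
     \<lparr>carrier = path_class X ` loops_at X x,
      monoid.mult = (\<lambda>A B. \<Union>p\<in>A. \<Union>q\<in>B. path_class X (path_join p q)),
      one = path_class X (\<lambda>_. x)\<rparr>"

definition induced_map :: "'b topology \<Rightarrow> ('a \<Rightarrow> 'b) \<Rightarrow> (real \<Rightarrow> 'a) set \<Rightarrow> (real \<Rightarrow> 'b) set" where
  "induced_map Y g c = (\<Union>\<gamma>\<in>c. path_class Y (g \<circ> \<gamma>))"


section \<open>First cohomotopy group and the comparison morphism\<close>

abbreviation circle :: "complex topology" where
  "circle \<equiv> top_of_set (sphere 0 1)"

definition map_class :: "'a topology \<Rightarrow> ('a \<Rightarrow> complex) \<Rightarrow> ('a \<Rightarrow> complex) set" where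
  "map_class X f = {g. homotopic_with (\<lambda>_. True) X circle f g}"

definition cohomotopy_group :: "'a topology \<Rightarrow> ('a \<Rightarrow> complex) set monoid" where
  "cohomotopy_group X =
     \<lparr>carrier = map_class X ` {f. continuous_map X circle f},
      monoid.mult = (\<lambda>A B. \<Union>f\<in>A. \<Union>g\<in>B. map_class X (\<lambda>x. f x * g x)),
      one = map_class X (\<lambda>_. 1)\<rparr>"

definition circle_degree :: "(real \<Rightarrow> complex) \<Rightarrow> int" where
  "circle_degree \<gamma> = (THE n. winding_number \<gamma> 0 = of_int n)"

text \<open>
  The identification of the fundamental group of the circle, at any base point, with the
  integers. All members of a class have the same degree.
\<close>

definition class_degree :: "(real \<Rightarrow> complex) set \<Rightarrow> int" where
  "class_degree c = the_elem (circle_degree ` c)"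

text \<open>
  Homomorphisms are taken as extensional functions, so that equality is equality on the carrier.
\<close>

definition Hom_group :: "('a, 'm) monoid_scheme \<Rightarrow> ('b, 'n) monoid_scheme \<Rightarrow> ('a \<Rightarrow> 'b) monoid"
  where
  "Hom_group G H =
     \<lparr>carrier = hom G H \<inter> extensional (carrier G),
      monoid.mult = (\<lambda>h k. \<lambda>c\<in>carrier G. h c \<otimes>\<^bsub>H\<^esub> k c),
      one = (\<lambda>c\<in>carrier G. \<one>\<^bsub>H\<^esub>)\<rparr>"

text \<open>
  \<open>comp\<close> sends \<open>[g]\<close> to \<open>g\<^sub>*\<close>; the value does not depend on the representative \<open>g\<close> of the
  homotopy class \<open>A\<close>.
\<close>

definition comparison :: "'a topology \<Rightarrow> 'a \<Rightarrow> ('a \<Rightarrow> complex) set \<Rightarrow> (real \<Rightarrow> 'a) set \<Rightarrow> int" where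
  "comparison X x A =
     (\<lambda>c\<in>carrier (fundamental_group X x).
        the_elem ((\<lambda>g. class_degree (induced_map circle g c)) ` A))"


section \<open>The loops generating the fundamental group\<close>

definition vertical_ray :: "real \<Rightarrow> bordered_point" where
  "vertical_ray p = Ray p (pi / 2)"

definition semicircle :: "real \<Rightarrow> real \<Rightarrow> bordered_point" where
  "semicircle t s =
     (if s \<le> 0 then vertical_ray 0
      else if s \<ge> 1 then vertical_ray t
      else Pt (Complex (t / 2 - t / 2 * cos (pi * s)) (\<bar>t\<bar> / 2 * sin (pi * s))))"

definition prufer_base :: "bordered_point \<times> bool" where
  "prufer_base = glue boundary_rays False (vertical_ray 0)"

definition alpha :: "real \<Rightarrow> real \<Rightarrow> bordered_point \<times> bool" where
  "alpha t = path_join (glue boundary_rays False \<circ> semicircle t)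
                       (\<lambda>s. glue boundary_rays True (semicircle t (1 - s)))"

abbreviation pi1_prufer :: "(real \<Rightarrow> bordered_point \<times> bool) set monoid" where
  "pi1_prufer \<equiv> fundamental_group prufer prufer_base"

abbreviation nonzero_reals :: "real set" where
  "nonzero_reals \<equiv> - {0}"

abbreviation int_functions :: "(real \<Rightarrow> int) monoid" where
  "int_functions \<equiv> product_group nonzero_reals (\<lambda>_. integer_group)"

text \<open>
  A homomorphism is identified with the function of its values on the free generators.
\<close>

definition on_generators :: "((real \<Rightarrow> bordered_point \<times> bool) set \<Rightarrow> int) \<Rightarrow> real \<Rightarrow> int" where
  "on_generators h = (\<lambda>t\<in>nonzero_reals. h (path_class prufer (alpha t)))"


section \<open>Baire-1 functions\<close>

definition baire1 :: "'a topology \<Rightarrow> 'b topology \<Rightarrow> ('a \<Rightarrow> 'b) \<Rightarrow> bool" where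
  "baire1 X Y f \<longleftrightarrow> f \<in> topspace X \<rightarrow> topspace Y \<and>
     (\<forall>U. openin Y U \<longrightarrow> fsigma_in X {x \<in> topspace X. f x \<in> U})"

end

theory Submission
  imports Defs
begin

text \<open>
  On each copy of the bordered surface a circle-valued map \<open>g\<close> lifts to a real function. Over the
  connected line of rays at \<open>p\<close> the two lifts differ by a constant \<open>2 * pi * n p\<close> with \<open>n p\<close> an integer,
  and the degree of \<open>g\<close> on the loop \<open>\<alpha>\<^sub>0\<^sub>,\<^sub>t\<close> is \<open>n t - n 0\<close>. If all these degrees vanish, then
  \<open>n\<close> is constant and, after a shift, the two lifts fit together to a lift of \<open>g\<close>, so \<open>g\<close> is
  null-homotopic. The function \<open>n\<close> is the pointwise limit of the continuous functions obtained by
  comparing the lifts at the points at height \<open>1 / m\<close>, hence it is Baire-1.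
  Conversely, a Baire-1 function \<open>n\<close> with integer values is a pointwise limit of continuous functions;
  interpolating between these at sufficiently fast decreasing heights gives a continuous
  function on the half-plane that tends to \<open>n p\<close> nontangentially at every \<open>p\<close>.
\<close>

section \<open>Degrees of loops in the circle\<close>

text \<open>The integers \<open>n p\<close> at different \<open>p\<close> are tied together only
  through the interior: a basic neighbourhood of a ray contains rays of one boundary line only.
  Hence \<open>n\<close> need not be continuous; what survives of continuity is that a continuous
  function on the half-plane tends to \<open>n p\<close> inside every cone at \<open>p\<close>. For
  the converse the obstacle is uniformity. The cones at \<open>p\<close> have arbitrary aperture,
  \<open>p\<close> ranges over an unbounded line, and approximations of \<open>n\<close> may
  converge at a speed depending on \<open>p\<close>. The first two are met by letting aperture and
  window grow with the index. The third disappears because \<open>n\<close> has countably many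
  values with F_sigma fibres: the approximations can be chosen to equal \<open>n p\<close> exactly
  from some index on, so that only their oscillation at the scale of the heights has to be
  estimated. Lifts over the bordered surface come from a logarithm on the convex half-plane; the
  rays are then reached as limits from a dense subset.\<close>

lemma continuous_map_mult:
  fixes f g :: "'a \<Rightarrow> 'b::real_normed_algebra"
  shows "\<lbrakk>continuous_map X euclidean f; continuous_map X euclidean g\<rbrakk>
    \<Longrightarrow> continuous_map X euclidean (\<lambda>x. f x * g x)"
  by (simp add: continuous_map_atin tendsto_mult)

lemma continuous_map_circle_iff:
  "continuous_map X circle f \<longleftrightarrow> continuous_map X euclidean f \<and> (\<forall>x\<in>topspace X. cmod (f x) = 1)"
  by (auto simp: continuous_map_in_subtopology)

lemma continuous_map_circle_mult:
  "\<lbrakk>continuous_map X circle f; continuous_map X circle g\<rbrakk> \<Longrightarrow> continuous_map X circle (\<lambda>x. f x * g x)"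
  by (simp add: continuous_map_circle_iff continuous_map_mult norm_mult)

lemma continuous_map_cis: "continuous_map X euclideanreal h \<Longrightarrow> continuous_map X circle (\<lambda>x. cis (h x))"
  unfolding continuous_map_circle_iff cis_conv_exp
  by (auto simp: continuous_map_atin intro!: tendsto_intros)

text \<open>A convex set is contractible, so \<open>f\<close> has a continuous logarithm; since
  \<open>f\<close> has modulus 1, the imaginary part of the logarithm already determines
  \<open>f\<close>.\<close>

lemma convex_circle_lift:
  fixes S :: "'a::real_normed_vector set"
  assumes "continuous_on S f" "convex S" "\<And>x. x \<in> S \<Longrightarrow> cmod (f x) = 1"
  obtains h where "continuous_on S h" "\<And>x. x \<in> S \<Longrightarrow> f x = cis (h x)"
proof -
  have nz: "f z \<noteq> 0" if "z \<in> S" for z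
    using assms(3)[OF that] by auto
  obtain g where g: "continuous_on S g" "\<And>x. x \<in> S \<Longrightarrow> f x = exp (g x)"
    using continuous_logarithm_on_contractible[OF assms(1) convex_imp_contractible[OF assms(2)] nz] by blast
  have "f x = cis (Im (g x))" if "x \<in> S" for x
    using assms(3)[OF that] g(2)[OF that] by (simp add: exp_eq_polar norm_mult)
  moreover have "continuous_on S (\<lambda>x. Im (g x))"
    using g(1) by (intro continuous_intros)
  ultimately show ?thesis using that by blast
qed

lemma pathin_circle_iff:
  "pathin circle \<gamma> \<longleftrightarrow> continuous_on {0..1} \<gamma> \<and> (\<forall>s\<in>{0..1}. cmod (\<gamma> s) = 1)"
  by (simp add: pathin_def continuous_map_circle_iff)

lemma winding_number_cis:
  assumes "continuous_on {0..1} H" "\<And>s. s \<in> {0..1} \<Longrightarrow> \<gamma> s = cis (H s)"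
  shows "winding_number \<gamma> 0 = of_real ((H 1 - H 0) / (2 * pi))"
proof -
  let ?p = "\<lambda>s. \<i> * of_real (H s)"
  have "winding_number \<gamma> 0 = winding_number (exp \<circ> ?p) 0"
    using assms(2) by (intro winding_number_cong) (simp add: cis_conv_exp)
  also have "\<dots> = (pathfinish ?p - pathstart ?p) / (2 * of_real pi * \<i>)"
    using assms(1) by (intro winding_number_compose_exp) (auto simp: path_def intro!: continuous_intros)
  also have "\<dots> = of_real ((H 1 - H 0) / (2 * pi))"
    by (simp add: pathfinish_def pathstart_def field_simps)
  finally show ?thesis .
qed

lemma circle_degree_lift:
  assumes "continuous_on {0..1} H" "\<And>s. s \<in> {0..1} \<Longrightarrow> \<gamma> s = cis (H s)"
    and "H 1 - H 0 = 2 * pi * of_int n"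
  shows "circle_degree \<gamma> = n"
proof -
  have "winding_number \<gamma> 0 = of_int n"
    using winding_number_cis[OF assms(1,2)] assms(3) by simp
  then show ?thesis unfolding circle_degree_def by auto
qed

lemma cis_eq_imp: "cis a = cis b \<Longrightarrow> \<exists>n::int. a - b = 2 * pi * of_int n"
proof -
  assume "cis a = cis b"
  then have "exp (\<i> * of_real a) = exp (\<i> * of_real b)" by (simp add: cis_conv_exp)
  then obtain n :: int where "\<i> * of_real a = \<i> * of_real b + (of_int (2 * n) * pi) * \<i>"
    by (auto simp: exp_eq)
  then have "Im (\<i> * of_real a) = Im (\<i> * of_real b + (of_int (2 * n) * pi) * \<i>)" by simp
  then show ?thesis by (intro exI[of _ n]) (simp add: algebra_simps)
qed

lemma circle_loop_lift:
  assumes "pathin circle \<gamma>" "\<gamma> 0 = \<gamma> 1"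
  obtains H where "continuous_on {0..1} H" "\<And>s. s \<in> {0..1} \<Longrightarrow> \<gamma> s = cis (H s)"
    "H 1 - H 0 = 2 * pi * of_int (circle_degree \<gamma>)"
proof -
  obtain H where H: "continuous_on {0..1} H" "\<And>s. s \<in> {0..1} \<Longrightarrow> \<gamma> s = cis (H s)"
    using convex_circle_lift[of "{0..1}" \<gamma>] assms(1) by (auto simp: pathin_circle_iff)
  moreover obtain n :: int where "H 1 - H 0 = 2 * pi * of_int n"
    using cis_eq_imp[of "H 1" "H 0"] H(2) assms(2) by force
  ultimately show ?thesis using that circle_degree_lift by metis
qed

lemma winding_number_circle_loop:
  assumes "pathin circle \<gamma>" "\<gamma> 0 = \<gamma> 1"
  shows "winding_number \<gamma> 0 = of_int (circle_degree \<gamma>)"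
proof -
  obtain H where "continuous_on {0..1} H" "\<And>s. s \<in> {0..1} \<Longrightarrow> \<gamma> s = cis (H s)"
    "H 1 - H 0 = 2 * pi * of_int (circle_degree \<gamma>)"
    using circle_loop_lift[OF assms] by blast
  then show ?thesis using winding_number_cis[of H \<gamma>] by simp
qed

lemma circle_degree_mult:
  assumes "pathin circle \<gamma>" "\<gamma> 0 = \<gamma> 1" "pathin circle \<delta>" "\<delta> 0 = \<delta> 1"
  shows "circle_degree (\<lambda>s. \<gamma> s * \<delta> s) = circle_degree \<gamma> + circle_degree \<delta>"
proof -
  obtain H where H: "continuous_on {0..1} H" "\<And>s. s \<in> {0..1} \<Longrightarrow> \<gamma> s = cis (H s)"
    "H 1 - H 0 = 2 * pi * of_int (circle_degree \<gamma>)"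
    using circle_loop_lift[OF assms(1,2)] by blast
  obtain K where K: "continuous_on {0..1} K" "\<And>s. s \<in> {0..1} \<Longrightarrow> \<delta> s = cis (K s)"
    "K 1 - K 0 = 2 * pi * of_int (circle_degree \<delta>)"
    using circle_loop_lift[OF assms(3,4)] by blast
  show ?thesis
  proof (rule circle_degree_lift)
    show "continuous_on {0..1} (\<lambda>s. H s + K s)" by (intro continuous_intros H K)
  qed (use H K in \<open>auto simp: cis_mult algebra_simps\<close>)
qed

lemma circle_degree_join:
  assumes "pathin circle \<gamma>" "\<gamma> 0 = \<gamma> 1" "pathin circle \<delta>" "\<delta> 0 = \<delta> 1" "\<gamma> 1 = \<delta> 0"
  shows "circle_degree (path_join \<gamma> \<delta>) = circle_degree \<gamma> + circle_degree \<delta>"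
proof -
  have "path_join \<gamma> \<delta> = \<gamma> +++ \<delta>" by (simp add: path_join_def joinpaths_def)
  moreover have "winding_number (\<gamma> +++ \<delta>) 0 = winding_number \<gamma> 0 + winding_number \<delta> 0"
    using assms
    by (intro winding_number_join)
       (auto simp: pathin_circle_iff path_def path_image_def pathfinish_def pathstart_def)
  ultimately have "winding_number (path_join \<gamma> \<delta>) 0 = of_int (circle_degree \<gamma> + circle_degree \<delta>)"
    using winding_number_circle_loop assms by simp
  then show ?thesis
    unfolding circle_degree_def[of "path_join \<gamma> \<delta>"] by (simp del: of_int_add)
qed

text \<open>The base point may move as long as every stage is a loop. This covers homotopies with
  fixed end points as well as those induced by a free homotopy of maps into the circle.\<close>

lemma circle_degree_homotopic:
  assumes "homotopic_with (\<lambda>r. r 0 = r 1) (top_of_set {0..1}) circle \<gamma> \<delta>"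
  shows "circle_degree \<gamma> = circle_degree \<delta>"
proof -
  have "homotopic_loops (sphere 0 1) \<gamma> \<delta>"
    using assms unfolding homotopic_loops_def pathfinish_def pathstart_def
    by (rule homotopic_with_mono) auto
  then have "homotopic_loops (-{0}) \<gamma> \<delta>"
    by (rule homotopic_loops_subset) auto
  then show ?thesis
    unfolding circle_degree_def using winding_number_homotopic_loops by metis
qed

section \<open>Path classes and the comparison morphism\<close>

lemma homotopic_path_imp_pathin:
  assumes "homotopic_with P (top_of_set {0..1}) X p q" shows "pathin X p" "pathin X q"
  using homotopic_with_imp_continuous_maps[OF assms] by (auto simp: pathin_def)

lemma path_class_self: "pathin X p \<Longrightarrow> p \<in> path_class X p"
  by (simp add: path_class_def pathin_def)

lemma path_class_memD:
  assumes "q \<in> path_class X p"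
  shows "q 0 = p 0" "q 1 = p 1" "pathin X p" "pathin X q"
proof -
  have h: "homotopic_with (\<lambda>r. r 0 = p 0 \<and> r 1 = p 1) (top_of_set {0..1}) X p q"
    using assms by (simp add: path_class_def)
  show "q 0 = p 0" "q 1 = p 1" using homotopic_with_imp_property[OF h] by auto
  show "pathin X p" "pathin X q" by (fact homotopic_path_imp_pathin[OF h])+
qed

lemma path_class_eq:
  assumes "q \<in> path_class X p"
  shows "path_class X q = path_class X p"
proof -
  have "homotopic_with (\<lambda>r. r 0 = p 0 \<and> r 1 = p 1) (top_of_set {0..1}) X p q"
    using assms by (simp add: path_class_def)
  then show ?thesis
    unfolding path_class_def path_class_memD(1,2)[OF assms]
    by (auto intro: homotopic_with_trans homotopic_with_symD)
qed

lemma pathin_join: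
  assumes "pathin X p" "pathin X q" "p 1 = q 0"
  shows "pathin X (path_join p q)"
  unfolding pathin_def path_join_def
proof (rule continuous_map_cases_le)
  show "continuous_map (subtopology (top_of_set {0..1}) {x \<in> topspace (top_of_set {0..1}). x \<le> 1 / 2}) X
     (\<lambda>x. p (2 * x))"
    by (rule continuous_map_compose[where g=p, unfolded o_def, OF _ assms(1)[unfolded pathin_def]])
       (auto simp: subtopology_subtopology intro!: continuous_intros)
  show "continuous_map (subtopology (top_of_set {0..1}) {x \<in> topspace (top_of_set {0..1}). 1 / 2 \<le> x}) X
     (\<lambda>x. q (2 * x - 1))"
    by (rule continuous_map_compose[where g=q, unfolded o_def, OF _ assms(2)[unfolded pathin_def]])
       (auto simp: subtopology_subtopology intro!: continuous_intros)
  show "p (2 * x) = q (2 * x - 1)" if "x = 1 / 2" for x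
    unfolding that by (simp add: assms(3))
qed (auto intro!: continuous_intros)

text \<open>The two homotopies are concatenated stage by stage; both keep their end points fixed, so
  they always meet at parameter 1/2.\<close>

lemma path_class_join:
  assumes p: "p' \<in> path_class X p" and q: "q' \<in> path_class X q" and pq: "p 1 = q 0"
  shows "path_join p' q' \<in> path_class X (path_join p q)"
proof -
  let ?I = "top_of_set {0..1::real}"
  let ?J = "prod_topology ?I ?I"
  obtain h where h: "continuous_map ?J X h" "\<And>x. h (0, x) = p x" "\<And>x. h (1, x) = p' x"
    "\<And>t. t \<in> {0..1} \<Longrightarrow> h (t, 0) = p 0 \<and> h (t, 1) = p 1"
    using p unfolding path_class_def homotopic_with_def by auto
  obtain k where k: "continuous_map ?J X k" "\<And>x. k (0, x) = q x" "\<And>x. k (1, x) = q' x"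
    "\<And>t. t \<in> {0..1} \<Longrightarrow> k (t, 0) = q 0 \<and> k (t, 1) = q 1"
    using q unfolding path_class_def homotopic_with_def by auto
  let ?H = "\<lambda>x. if snd x \<le> 1/2 then h (fst x, 2 * snd x) else k (fst x, 2 * snd x - 1)"
  have J: "?J = top_of_set ({0..1} \<times> {0..1})"
    by (simp add: subtopology_Times[symmetric] euclidean_product_topology[symmetric])
  have "continuous_map ?J X ?H"
  proof (rule continuous_map_cases_le)
    show "continuous_map (subtopology ?J {x \<in> topspace ?J. snd x \<le> 1 / 2}) X (\<lambda>x. h (fst x, 2 * snd x))"
      by (rule continuous_map_compose[where g=h, unfolded o_def, OF _ h(1)])
         (auto simp: J subtopology_subtopology intro!: continuous_intros)
    show "continuous_map (subtopology ?J {x \<in> topspace ?J. 1 / 2 \<le> snd x}) X (\<lambda>x. k (fst x, 2 * snd x - 1))"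
      by (rule continuous_map_compose[where g=k, unfolded o_def, OF _ k(1)])
         (auto simp: J subtopology_subtopology intro!: continuous_intros)
    show "h (fst x, 2 * snd x) = k (fst x, 2 * snd x - 1)"
      if "x \<in> topspace ?J" "snd x = 1 / 2" for x
      using that(1) h(4)[of "fst x"] k(4)[of "fst x"] pq unfolding that(2) by (auto simp: J)
  qed (auto simp: J intro!: continuous_intros)
  then show ?thesis
    unfolding path_class_def homotopic_with_def
    using h k by (auto intro!: exI[of _ ?H] simp: path_join_def)
qed

lemma path_join_loop: "\<lbrakk>p \<in> loops_at X x; q \<in> loops_at X x\<rbrakk> \<Longrightarrow> path_join p q \<in> loops_at X x"
  using pathin_join[of X p q] by (auto simp: loops_at_def path_join_def)

text \<open>The multiplication is a union over all pairs of representatives. Every pair yields the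
  same class and both classes are inhabited, so the union collapses to that class.\<close>

lemma mult_fundamental_group:
  assumes "p \<in> loops_at X x" "q \<in> loops_at X x"
  shows "path_class X p \<otimes>\<^bsub>fundamental_group X x\<^esub> path_class X q = path_class X (path_join p q)"
proof -
  have "path_class X (path_join p' q') = path_class X (path_join p q)"
    if "p' \<in> path_class X p" "q' \<in> path_class X q" for p' q'
    using assms by (intro path_class_eq path_class_join that) (simp add: loops_at_def)
  moreover have "path_class X p \<noteq> {}" "path_class X q \<noteq> {}"
    using assms path_class_self[of X p] path_class_self[of X q] by (auto simp: loops_at_def)
  ultimately show ?thesis by (auto simp: fundamental_group_def)
qed

section \<open>Homotopy classes of maps into the circle and their degrees on loops\<close>

lemma map_class_eq: "g \<in> map_class X f \<Longrightarrow> map_class X g = map_class X f"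
  unfolding map_class_def by (auto intro: homotopic_with_trans homotopic_with_symD)

lemma map_class_self: "continuous_map X circle f \<Longrightarrow> f \<in> map_class X f"
  by (simp add: map_class_def)

lemma map_class_mult:
  assumes "f' \<in> map_class X f" "g' \<in> map_class X g"
  shows "(\<lambda>x. f' x * g' x) \<in> map_class X (\<lambda>x. f x * g x)"
proof -
  let ?J = "prod_topology (top_of_set {0..1::real}) X"
  obtain h where h: "continuous_map ?J circle h" "\<And>x. h (0, x) = f x" "\<And>x. h (1, x) = f' x"
    using assms unfolding map_class_def homotopic_with_def by auto
  obtain k where k: "continuous_map ?J circle k" "\<And>x. k (0, x) = g x" "\<And>x. k (1, x) = g' x"
    using assms unfolding map_class_def homotopic_with_def by auto
  have "continuous_map ?J circle (\<lambda>x. h x * k x)"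
    by (intro continuous_map_circle_mult h k)
  then show ?thesis
    unfolding map_class_def homotopic_with_def
    using h k by (auto intro!: exI[of _ "\<lambda>x. h x * k x"])
qed

lemma mult_cohomotopy_group:
  assumes "continuous_map X circle f" "continuous_map X circle g"
  shows "map_class X f \<otimes>\<^bsub>cohomotopy_group X\<^esub> map_class X g = map_class X (\<lambda>x. f x * g x)"
proof -
  have "map_class X (\<lambda>x. f' x * g' x) = map_class X (\<lambda>x. f x * g x)"
    if "f' \<in> map_class X f" "g' \<in> map_class X g" for f' g'
    using map_class_mult[OF that] map_class_eq by blast
  moreover have "map_class X f \<noteq> {}" "map_class X g \<noteq> {}"
    using assms map_class_self by blast+
  ultimately show ?thesis by (auto simp: cohomotopy_group_def)
qed

lemma circle_loop_compose:
  assumes "continuous_map X circle g" "\<gamma> \<in> loops_at X x"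
  shows "pathin circle (g \<circ> \<gamma>)" "(g \<circ> \<gamma>) 0 = (g \<circ> \<gamma>) 1"
  using assms pathin_compose by (auto simp: loops_at_def)

lemma class_degree_path_class:
  assumes "pathin circle \<gamma>" "\<gamma> 0 = \<gamma> 1"
  shows "class_degree (path_class circle \<gamma>) = circle_degree \<gamma>"
proof -
  have "circle_degree \<delta> = circle_degree \<gamma>" if "\<delta> \<in> path_class circle \<gamma>" for \<delta>
  proof -
    have "homotopic_with (\<lambda>r. r 0 = r 1) (top_of_set {0..1}) circle \<gamma> \<delta>"
      by (rule homotopic_with_mono[OF that[unfolded path_class_def mem_Collect_eq]]) (use assms(2) in auto)
    then show ?thesis using circle_degree_homotopic by metis
  qed
  then have "circle_degree ` path_class circle \<gamma> = {circle_degree \<gamma>}"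
    using path_class_self[OF assms(1)] by blast
  then show ?thesis by (simp add: class_degree_def)
qed

lemma induced_map_path_class:
  assumes "continuous_map X Y g" "pathin X \<gamma>"
  shows "induced_map Y g (path_class X \<gamma>) = path_class Y (g \<circ> \<gamma>)"
proof -
  have "path_class Y (g \<circ> \<delta>) = path_class Y (g \<circ> \<gamma>)" if "\<delta> \<in> path_class X \<gamma>" for \<delta>
  proof (rule path_class_eq)
    show "g \<circ> \<delta> \<in> path_class Y (g \<circ> \<gamma>)"
      unfolding path_class_def mem_Collect_eq
      by (rule homotopic_with_compose_continuous_map_left
          [OF that[unfolded path_class_def mem_Collect_eq] assms(1)]) auto
  qed
  then have "induced_map Y g (path_class X \<gamma>) = (\<Union>\<delta>\<in>path_class X \<gamma>. path_class Y (g \<circ> \<gamma>))"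
    unfolding induced_map_def by (intro SUP_cong refl)
  then show ?thesis using path_class_self[OF assms(2)] by blast
qed

text \<open>A free homotopy from \<open>g\<close> to another representative, composed with
  \<open>\<gamma>\<close>, runs through loops. All representatives therefore give one degree, and
  \<open>the_elem\<close> is applied to a singleton.\<close>

lemma comparison_class:
  assumes "continuous_map X circle g" "\<gamma> \<in> loops_at X x"
  shows "comparison X x (map_class X g) (path_class X \<gamma>) = circle_degree (g \<circ> \<gamma>)"
proof -
  have \<gamma>: "pathin X \<gamma>" "\<gamma> 0 = \<gamma> 1" using assms(2) by (auto simp: loops_at_def)
  have "class_degree (induced_map circle f (path_class X \<gamma>)) = circle_degree (g \<circ> \<gamma>)"
    if "f \<in> map_class X g" for f
  proof -
    have hom: "homotopic_with (\<lambda>_. True) X circle g f" using that by (simp add: map_class_def)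
    then have f: "continuous_map X circle f" using homotopic_with_imp_continuous_maps by blast
    have "homotopic_with (\<lambda>r. r 0 = r 1) (top_of_set {0..1}) circle (g \<circ> \<gamma>) (f \<circ> \<gamma>)"
      using \<gamma> by (intro homotopic_with_compose_continuous_map_right[OF hom]) (auto simp: pathin_def)
    then have "circle_degree (g \<circ> \<gamma>) = circle_degree (f \<circ> \<gamma>)"
      by (rule circle_degree_homotopic)
    then show ?thesis
      using induced_map_path_class[OF f \<gamma>(1)] class_degree_path_class circle_loop_compose[OF f assms(2)]
      by simp
  qed
  then have "(\<lambda>f. class_degree (induced_map circle f (path_class X \<gamma>))) ` map_class X g
      = (\<lambda>_. circle_degree (g \<circ> \<gamma>)) ` map_class X g"
    by (intro image_cong refl)
  also have "\<dots> = {circle_degree (g \<circ> \<gamma>)}"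
    using map_class_self[OF assms(1)] by blast
  finally have "(\<lambda>f. class_degree (induced_map circle f (path_class X \<gamma>))) ` map_class X g
      = {circle_degree (g \<circ> \<gamma>)}" .
  moreover have "path_class X \<gamma> \<in> carrier (fundamental_group X x)"
    using assms(2) by (simp add: fundamental_group_def)
  ultimately show ?thesis by (simp add: comparison_def)
qed

lemma comparison_in_hom:
  assumes g: "continuous_map X circle g"
  shows "comparison X x (map_class X g) \<in> hom (fundamental_group X x) integer_group"
proof (rule homI)
  fix c d
  assume "c \<in> carrier (fundamental_group X x)" "d \<in> carrier (fundamental_group X x)"
  then obtain p q where p: "p \<in> loops_at X x" "c = path_class X p"
    and q: "q \<in> loops_at X x" "d = path_class X q"
    by (auto simp: fundamental_group_def)
  have "g \<circ> path_join p q = path_join (g \<circ> p) (g \<circ> q)"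
    by (auto simp: path_join_def)
  moreover have "circle_degree (path_join (g \<circ> p) (g \<circ> q)) = circle_degree (g \<circ> p) + circle_degree (g \<circ> q)"
    using p q circle_loop_compose[OF g] by (intro circle_degree_join) (auto simp: loops_at_def)
  ultimately show "comparison X x (map_class X g) (c \<otimes>\<^bsub>fundamental_group X x\<^esub> d)
      = comparison X x (map_class X g) c \<otimes>\<^bsub>integer_group\<^esub> comparison X x (map_class X g) d"
    using comparison_class[OF g] p q path_join_loop[OF p(1) q(1)]
    by (simp add: mult_fundamental_group)
qed simp

lemma comparison_mult:
  assumes f: "continuous_map X circle f" and g: "continuous_map X circle g"
    and c: "c \<in> carrier (fundamental_group X x)"
  shows "comparison X x (map_class X f \<otimes>\<^bsub>cohomotopy_group X\<^esub> map_class X g) c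
    = comparison X x (map_class X f) c + comparison X x (map_class X g) c"
proof -
  obtain p where p: "p \<in> loops_at X x" "c = path_class X p"
    using c by (auto simp: fundamental_group_def)
  have "(\<lambda>x. f x * g x) \<circ> p = (\<lambda>s. (f \<circ> p) s * (g \<circ> p) s)" by auto
  moreover have "circle_degree (\<lambda>s. (f \<circ> p) s * (g \<circ> p) s) = circle_degree (f \<circ> p) + circle_degree (g \<circ> p)"
    using circle_loop_compose[OF f p(1)] circle_loop_compose[OF g p(1)] by (rule circle_degree_mult)
  ultimately show ?thesis
    using comparison_class[OF continuous_map_circle_mult[OF f g] p(1)]
      comparison_class[OF f p(1)] comparison_class[OF g p(1)]
    by (simp add: mult_cohomotopy_group[OF f g] p(2))
qed

lemma comparison_hom:
  "comparison X x \<in> hom (cohomotopy_group X) (Hom_group (fundamental_group X x) integer_group)"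
proof (rule homI)
  fix a assume "a \<in> carrier (cohomotopy_group X)"
  then show "comparison X x a \<in> carrier (Hom_group (fundamental_group X x) integer_group)"
    using comparison_in_hom by (auto simp: cohomotopy_group_def Hom_group_def comparison_def)
next
  fix a b assume "a \<in> carrier (cohomotopy_group X)" "b \<in> carrier (cohomotopy_group X)"
  then obtain f g where "continuous_map X circle f" "a = map_class X f"
    "continuous_map X circle g" "b = map_class X g"
    by (auto simp: cohomotopy_group_def)
  then have "comparison X x (a \<otimes>\<^bsub>cohomotopy_group X\<^esub> b) c
      = (\<lambda>c\<in>carrier (fundamental_group X x). comparison X x a c + comparison X x b c) c" for c
    using comparison_mult[of X f g c x]
    by (cases "c \<in> carrier (fundamental_group X x)") (auto simp: comparison_def)
  then show "comparison X x (a \<otimes>\<^bsub>cohomotopy_group X\<^esub> b)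
      = comparison X x a \<otimes>\<^bsub>Hom_group (fundamental_group X x) integer_group\<^esub> comparison X x b"
    by (auto simp: Hom_group_def)
qed

section \<open>Topology of the bordered Pruefer surface\<close>

abbreviation upper_half :: "complex set" where
  "upper_half \<equiv> {z. Im z > 0}"

lemma Arg_upper: "Im z > 0 \<Longrightarrow> 0 < Arg z \<and> Arg z < pi"
  using Arg_lt_pi by blast

lemma continuous_on_Arg_upper: "continuous_on upper_half (\<lambda>z. Arg (z - of_real p))"
  by (rule continuous_on_compose2[OF continuous_on_Arg]) (auto intro!: continuous_intros simp: complex_nonpos_Reals_iff)

lemma Pt_mem_ray_nhd:
  "Pt z \<in> ray_nhd p \<theta> \<epsilon> \<longleftrightarrow> Im z > 0 \<and> cmod (z - of_real p) < \<epsilon> \<and> \<bar>Arg (z - of_real p) - \<theta>\<bar> < \<epsilon>"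
  by (auto simp: ray_nhd_def)

lemma Ray_mem_ray_nhd:
  "Ray q \<phi> \<in> ray_nhd p \<theta> \<epsilon> \<longleftrightarrow> q = p \<and> 0 < \<phi> \<and> \<phi> < pi \<and> \<bar>\<phi> - \<theta>\<bar> < \<epsilon>"
  by (auto simp: ray_nhd_def)

lemma Pt_mem_bordered: "Pt z \<in> bordered_points \<longleftrightarrow> Im z > 0"
  and Ray_mem_bordered: "Ray p \<theta> \<in> bordered_points \<longleftrightarrow> 0 < \<theta> \<and> \<theta> < pi"
  and Ray_mem_boundary: "Ray p \<theta> \<in> boundary_rays \<longleftrightarrow> 0 < \<theta> \<and> \<theta> < pi"
  by (auto simp: bordered_points_def boundary_rays_def)

text \<open>Polar coordinates at \<open>p\<close> make the planar part of a basic neighbourhood the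
  image of a rectangle, from which it is seen to be connected and, at a boundary ray,
  nonempty.\<close>

lemma ray_nhd_polar:
  "{z. Pt z \<in> ray_nhd p \<theta> \<epsilon>} =
    (\<lambda>(r, \<phi>). of_real p + of_real r * cis \<phi>) ` ({0<..<\<epsilon>} \<times> ({0<..<pi} \<inter> {\<theta>-\<epsilon><..<\<theta>+\<epsilon>}))"
    (is "?W = ?f ` ?B")
proof (intro equalityI subsetI)
  fix z assume "z \<in> ?W"
  then have z: "Im (z - of_real p) > 0" "cmod (z - of_real p) < \<epsilon>" "\<bar>Arg (z - of_real p) - \<theta>\<bar> < \<epsilon>"
    by (auto simp: Pt_mem_ray_nhd)
  then have "z - of_real p \<noteq> 0" by auto
  then have "z = ?f (cmod (z - of_real p), Arg (z - of_real p))"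
    using cis_Arg[of "z - of_real p"] rcis_cmod_Arg[of "z - of_real p"]
    by (simp add: rcis_def)
  moreover have "(cmod (z - of_real p), Arg (z - of_real p)) \<in> ?B"
    using z Arg_upper[OF z(1)] \<open>z - of_real p \<noteq> 0\<close> by auto
  ultimately show "z \<in> ?f ` ?B" by blast
next
  fix z assume "z \<in> ?f ` ?B"
  then obtain r \<phi> where "0 < r" "r < \<epsilon>" "0 < \<phi>" "\<phi> < pi" "\<bar>\<phi> - \<theta>\<bar> < \<epsilon>"
    and "z = of_real p + of_real r * cis \<phi>"
    by auto
  then show "z \<in> ?W"
    by (simp add: Pt_mem_ray_nhd Arg_times_of_real Arg_cis norm_mult sin_gt_zero)
qed

lemma connected_ray_nhd: "connected {z. Pt z \<in> ray_nhd p \<theta> \<epsilon>}"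
proof -
  have "convex ({0<..<\<epsilon>} \<times> ({0<..<pi} \<inter> {\<theta>-\<epsilon><..<\<theta>+\<epsilon>}))"
    by (intro convex_Times convex_Int) auto
  then show ?thesis
    unfolding ray_nhd_polar split_def
    by (intro connected_continuous_image continuous_intros convex_connected)
qed

lemma ray_nhd_meets:
  assumes "0 < \<theta>" "\<theta> < pi" "\<epsilon> > 0"
  shows "\<exists>z. Pt z \<in> ray_nhd p \<theta> \<epsilon>"
proof -
  have "(\<epsilon> / 2, \<theta>) \<in> {0<..<\<epsilon>} \<times> ({0<..<pi} \<inter> {\<theta>-\<epsilon><..<\<theta>+\<epsilon>})"
    using assms by auto
  then show ?thesis using ray_nhd_polar[of p \<theta> \<epsilon>] by blast
qed

lemma openin_ray_nhd: "openin bordered_prufer (ray_nhd p \<theta> \<epsilon>)"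
  unfolding openin_bordered_prufer bordered_open_def
proof (intro conjI allI impI)
  show "ray_nhd p \<theta> \<epsilon> \<subseteq> bordered_points"
    by (auto simp: ray_nhd_def bordered_points_def boundary_rays_def)
  have "{z. Pt z \<in> ray_nhd p \<theta> \<epsilon>} =
    upper_half \<inter> {z. cmod (z - of_real p) < \<epsilon>} \<inter> (upper_half \<inter> (\<lambda>z. Arg (z - of_real p)) -` ball \<theta> \<epsilon>)"
    by (auto simp: Pt_mem_ray_nhd dist_real_def)
  moreover have "open (upper_half \<inter> (\<lambda>z. Arg (z - of_real p)) -` ball \<theta> \<epsilon>)"
    using continuous_on_Arg_upper[of p] unfolding continuous_on_open_vimage[OF open_halfspace_Im_gt]
    by (simp add: Int_commute)
  moreover have "open {z. cmod (z - of_real p) < \<epsilon>}"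
    by (intro open_Collect_less continuous_intros)
  ultimately show "open {z. Pt z \<in> ray_nhd p \<theta> \<epsilon>}"
    using open_halfspace_Im_gt[of 0] by (simp only: open_Int)
next
  fix q \<phi> assume "Ray q \<phi> \<in> ray_nhd p \<theta> \<epsilon>"
  then have q: "q = p" "\<bar>\<phi> - \<theta>\<bar> < \<epsilon>" by (auto simp: Ray_mem_ray_nhd)
  \<comment> \<open>By the triangle inequality for angles, the radius left over after moving from
    \<open>\<theta>\<close> to \<open>\<phi>\<close> suffices; the origin \<open>p\<close> stays the
    same.\<close>
  then have "ray_nhd q \<phi> (\<epsilon> - \<bar>\<phi> - \<theta>\<bar>) \<subseteq> ray_nhd p \<theta> \<epsilon>"
    by (auto simp: ray_nhd_def)
  then show "\<exists>\<delta>>0. ray_nhd q \<phi> \<delta> \<subseteq> ray_nhd p \<theta> \<epsilon>" using q(2) by (intro exI[of _ "\<epsilon> - \<bar>\<phi> - \<theta>\<bar>"]) auto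
qed

lemma openin_Pt_image: "\<lbrakk>open U; U \<subseteq> upper_half\<rbrakk> \<Longrightarrow> openin bordered_prufer (Pt ` U)"
  by (auto simp: openin_bordered_prufer bordered_open_def Pt_mem_bordered image_iff)

lemma continuous_map_bordered_iff:
  fixes f :: "bordered_point \<Rightarrow> 'a::metric_space"
  shows "continuous_map bordered_prufer euclidean f \<longleftrightarrow>
    continuous_on upper_half (f \<circ> Pt) \<and>
    (\<forall>p \<theta> e. 0 < \<theta> \<and> \<theta> < pi \<and> e > 0 \<longrightarrow>
      (\<exists>\<epsilon>>0. \<forall>x\<in>ray_nhd p \<theta> \<epsilon>. dist (f x) (f (Ray p \<theta>)) < e))" (is "?L \<longleftrightarrow> ?R1 \<and> ?R2")
proof (intro iffI conjI allI impI)
  assume L: ?L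
  show ?R1
    unfolding continuous_on_open_vimage[OF open_halfspace_Im_gt]
  proof (intro allI impI)
    fix U :: "'a set" assume "open U"
    then have "bordered_open {x \<in> bordered_points. f x \<in> U}"
      using L by (simp add: continuous_map_def topspace_bordered_prufer openin_bordered_prufer)
    moreover have "(f \<circ> Pt) -` U \<inter> upper_half = {z. Pt z \<in> {x \<in> bordered_points. f x \<in> U}}"
      by (auto simp: Pt_mem_bordered)
    ultimately show "open ((f \<circ> Pt) -` U \<inter> upper_half)"
      unfolding bordered_open_def by simp
  qed
  fix p \<theta> e :: real assume "0 < \<theta> \<and> \<theta> < pi \<and> e > 0"
  moreover have "bordered_open {x \<in> bordered_points. f x \<in> ball (f (Ray p \<theta>)) e}"
    using L by (simp add: continuous_map_def topspace_bordered_prufer openin_bordered_prufer del: mem_ball)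
  ultimately obtain \<epsilon> where "\<epsilon> > 0" "ray_nhd p \<theta> \<epsilon> \<subseteq> {x \<in> bordered_points. f x \<in> ball (f (Ray p \<theta>)) e}"
    unfolding bordered_open_def mem_Collect_eq Ray_mem_bordered by (metis centre_in_ball)
  then show "\<exists>\<epsilon>>0. \<forall>x\<in>ray_nhd p \<theta> \<epsilon>. dist (f x) (f (Ray p \<theta>)) < e"
    by (auto simp: dist_commute)
next
  assume R: "?R1 \<and> ?R2"
  have "bordered_open {x \<in> bordered_points. f x \<in> U}" if U: "open U" for U
    unfolding bordered_open_def
  proof (intro conjI allI impI)
    have "open ((f \<circ> Pt) -` U \<inter> upper_half)"
      using R U unfolding continuous_on_open_vimage[OF open_halfspace_Im_gt] by blast
    moreover have "(f \<circ> Pt) -` U \<inter> upper_half = {z. Pt z \<in> {x \<in> bordered_points. f x \<in> U}}"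
      by (auto simp: Pt_mem_bordered)
    ultimately show "open {z. Pt z \<in> {x \<in> bordered_points. f x \<in> U}}" by simp
    fix p \<theta> assume "Ray p \<theta> \<in> {x \<in> bordered_points. f x \<in> U}"
    then have r: "0 < \<theta>" "\<theta> < pi" "f (Ray p \<theta>) \<in> U" by (auto simp: Ray_mem_bordered)
    obtain e where e: "e > 0" "ball (f (Ray p \<theta>)) e \<subseteq> U" using U r(3) open_contains_ball by blast
    obtain \<epsilon> where "\<epsilon> > 0" "\<forall>x\<in>ray_nhd p \<theta> \<epsilon>. dist (f x) (f (Ray p \<theta>)) < e"
      using R r e by blast
    moreover have "ray_nhd p \<theta> \<epsilon> \<subseteq> bordered_points"
      using openin_ray_nhd openin_subset topspace_bordered_prufer by blast
    ultimately show "\<exists>\<epsilon>>0. ray_nhd p \<theta> \<epsilon> \<subseteq> {x \<in> bordered_points. f x \<in> U}"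
      using e(2) by (intro exI[of _ \<epsilon>]) (auto simp: dist_commute subset_iff)
  qed auto
  then show ?L
    by (simp add: continuous_map_def topspace_bordered_prufer openin_bordered_prufer)
qed

text \<open>Density of the interior is what lets a lift be extended to the rays by limits, and an
  identity between continuous maps be carried over to them.\<close>

lemma closure_of_Pt: "bordered_prufer closure_of (Pt ` upper_half) = bordered_points"
proof
  show "bordered_prufer closure_of (Pt ` upper_half) \<subseteq> bordered_points"
    using closure_of_subset_topspace topspace_bordered_prufer by metis
  show "bordered_points \<subseteq> bordered_prufer closure_of (Pt ` upper_half)"
  proof
    fix x assume x: "x \<in> bordered_points"
    have "\<exists>y. y \<in> Pt ` upper_half \<and> y \<in> T" if "x \<in> T" "openin bordered_prufer T" for T
    proof (cases x)
      case (Pt z)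
      then show ?thesis using x that by (auto simp: Pt_mem_bordered)
    next
      case (Ray p \<theta>)
      have "Ray p \<theta> \<in> T" "bordered_open T" using that Ray by (auto simp: openin_bordered_prufer)
      then obtain \<epsilon> where e: "\<epsilon> > 0" "ray_nhd p \<theta> \<epsilon> \<subseteq> T"
        unfolding bordered_open_def by metis
      obtain z where z: "Pt z \<in> ray_nhd p \<theta> \<epsilon>"
        using ray_nhd_meets[OF _ _ e(1)] x Ray by (auto simp: Ray_mem_bordered)
      then have "Im z > 0" by (simp add: Pt_mem_ray_nhd)
      then show ?thesis using e(2) z by blast
    qed
    then show "x \<in> bordered_prufer closure_of (Pt ` upper_half)"
      using x by (auto simp: in_closure_of topspace_bordered_prufer)
  qed
qed

section \<open>Lifting circle-valued maps over the bordered surface\<close>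

lemma cis_constant_imp_constant:
  fixes k :: "'a::topological_space \<Rightarrow> real"
  assumes "connected S" "continuous_on S k" "\<And>x. x \<in> S \<Longrightarrow> cis (k x) = c"
  obtains a where "\<And>x. x \<in> S \<Longrightarrow> k x = a"
proof -
  have "k constant_on S"
  proof (rule continuous_discrete_range_constant[OF assms(1,2)])
    fix x assume x: "x \<in> S"
    \<comment> \<open>Two values of \<open>k\<close> differ by a multiple of 2 pi, so distinct ones
      are at least 2 pi apart; a continuous function with such a discrete range is constant on a
      connected set.\<close>
    have "2 * pi \<le> norm (k y - k x)" if y: "y \<in> S" "k y \<noteq> k x" for y
    proof -
      obtain n :: int where n: "k y - k x = 2 * pi * of_int n"
        using cis_eq_imp assms(3) x y by metis
      then have "n \<noteq> 0" using y by auto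
      then have "1 \<le> \<bar>real_of_int n\<bar>" by linarith
      then show ?thesis unfolding n by (simp add: abs_mult)
    qed
    then show "\<exists>e>0. \<forall>y. y \<in> S \<and> k y \<noteq> k x \<longrightarrow> e \<le> norm (k y - k x)"
      using pi_gt_zero by (intro exI[of _ "2 * pi"]) auto
  qed
  then show ?thesis using that by (auto simp: constant_on_def)
qed

text \<open>Near a boundary ray a circle-valued map stays in a half-plane, so a lift over the simply
  connected interior differs there from a branch of the argument by a constant, and hence
  converges at the ray.\<close>

lemma bordered_lift:
  assumes g: "continuous_map bordered_prufer circle g"
  obtains h where "continuous_map bordered_prufer euclideanreal h"
    "\<And>x. x \<in> bordered_points \<Longrightarrow> g x = cis (h x)"
proof -
  have ge: "continuous_map bordered_prufer euclidean g"
    and g1: "\<And>x. x \<in> bordered_points \<Longrightarrow> cmod (g x) = 1"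
    using g by (auto simp: continuous_map_circle_iff topspace_bordered_prufer)
  have gPt: "continuous_on upper_half (g \<circ> Pt)"
    using ge continuous_map_bordered_iff by blast
  obtain h where h: "continuous_on upper_half h" "\<And>z. Im z > 0 \<Longrightarrow> g (Pt z) = cis (h z)"
    using convex_circle_lift[OF gPt convex_halfspace_Im_gt] g1 by (auto simp: Pt_mem_bordered)
  \<comment> \<open>The value 0 on rays is a placeholder: only the values of \<open>f\<close> on
    \<open>?S\<close> and its limits along \<open>?S\<close> enter.\<close>
  define f where "f x = (case x of Pt z \<Rightarrow> h z | Ray p \<theta> \<Rightarrow> 0)" for x
  let ?S = "Pt ` upper_half"
  have S: "openin bordered_prufer ?S" by (intro openin_Pt_image open_halfspace_Im_gt) auto
  have f: "continuous_map (subtopology bordered_prufer ?S) euclideanreal f"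
    unfolding continuous_map_def
  proof (intro conjI allI impI)
    fix U :: "real set" assume "openin euclideanreal U"
    then have "open (h -` U \<inter> upper_half)"
      using h(1) continuous_on_open_vimage[OF open_halfspace_Im_gt] by auto
    then have "openin bordered_prufer (Pt ` (h -` U \<inter> upper_half))"
      by (intro openin_Pt_image) auto
    moreover have "{x \<in> topspace (subtopology bordered_prufer ?S). f x \<in> U} = Pt ` (h -` U \<inter> upper_half)"
      by (auto simp: f_def topspace_bordered_prufer Pt_mem_bordered)
    ultimately show "openin (subtopology bordered_prufer ?S) {x \<in> topspace (subtopology bordered_prufer ?S). f x \<in> U}"
      using openin_open_subtopology[OF S] by auto
  qed auto
  have lim: "\<exists>l. limitin euclideanreal f l (atin_within bordered_prufer t ?S)"
    if t_in: "t \<in> bordered_points - ?S" for t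
  proof -
    obtain p \<theta> where t: "t = Ray p \<theta>" "0 < \<theta>" "\<theta> < pi"
      using t_in by (cases t) (auto simp: Pt_mem_bordered Ray_mem_bordered)
    have gt: "cmod (g t) = 1" "g t \<noteq> 0" using g1[of t] t by (auto simp: Ray_mem_bordered)
    \<comment> \<open>Dividing by \<open>g t\<close> moves the value at \<open>t\<close> to 1, away
      from the branch cut of \<open>Arg\<close>.\<close>
    have near: "\<exists>\<epsilon>>0. \<forall>x\<in>ray_nhd p \<theta> \<epsilon>. dist (g x / g t) 1 < e" if "e > 0" for e
    proof -
      obtain \<epsilon> where "\<epsilon> > 0" "\<forall>x\<in>ray_nhd p \<theta> \<epsilon>. dist (g x) (g (Ray p \<theta>)) < e"
        using ge t \<open>e > 0\<close> unfolding continuous_map_bordered_iff by blast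
      moreover have "dist (g x / g t) 1 = dist (g x) (g t)" for x
      proof -
        have "g x / g t - 1 = (g x - g t) / g t" using gt by (simp add: field_simps)
        then show ?thesis using gt by (simp add: dist_norm norm_divide)
      qed
      ultimately show ?thesis using t by metis
    qed
    \<comment> \<open>Distance less than 1 from 1 keeps the quotient in the open right half-plane,
      where \<open>Arg\<close> is continuous.\<close>
    obtain \<delta> where \<delta>: "\<delta> > 0" "\<And>x. x \<in> ray_nhd p \<theta> \<delta> \<Longrightarrow> dist (g x / g t) 1 < 1"
      using near[of 1] by auto
    have pos: "g (Pt z) / g t \<notin> \<real>\<^sub>\<le>\<^sub>0" if "Pt z \<in> ray_nhd p \<theta> \<delta>" for z
    proof -
      have "\<bar>Re (g (Pt z) / g t - 1)\<bar> < 1"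
        using \<delta>(2)[OF that] abs_Re_le_cmod le_less_trans unfolding dist_norm by blast
      then show ?thesis by (auto simp: complex_nonpos_Reals_iff)
    qed
    have "continuous_on {z. Pt z \<in> ray_nhd p \<theta> \<delta>} (\<lambda>z. g (Pt z) / g t)"
      using gPt gt by (auto intro!: continuous_intros continuous_on_subset[OF gPt[unfolded o_def]] simp: Pt_mem_ray_nhd)
    then have "continuous_on {z. Pt z \<in> ray_nhd p \<theta> \<delta>} (\<lambda>z. h z - Arg (g (Pt z) / g t))"
      using pos
      by (auto intro!: continuous_intros continuous_on_subset[OF h(1)] continuous_on_compose2[OF continuous_on_Arg]
          simp: Pt_mem_ray_nhd)
    moreover have "cis (h z - Arg (g (Pt z) / g t)) = g t" if "z \<in> {z. Pt z \<in> ray_nhd p \<theta> \<delta>}" for z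
    proof -
      have z: "Im z > 0" using that by (simp add: Pt_mem_ray_nhd)
      then have "cmod (g (Pt z) / g t) = 1" using g1 gt by (simp add: norm_divide Pt_mem_bordered)
      then have "cis (Arg (g (Pt z) / g t)) = g (Pt z) / g t"
        using rcis_cmod_Arg[of "g (Pt z) / g t"] by (simp add: rcis_def)
      then show ?thesis using h(2)[OF z] gt by (simp add: cis_divide[symmetric])
    qed
    ultimately obtain a where a: "\<And>z. Pt z \<in> ray_nhd p \<theta> \<delta> \<Longrightarrow> h z - Arg (g (Pt z) / g t) = a"
      using cis_constant_imp_constant[OF connected_ray_nhd] by (metis (no_types, lifting) mem_Collect_eq)
    have "limitin euclideanreal f a (atin_within bordered_prufer t ?S)"
      unfolding limitin_canonical_iff
    proof (rule tendstoI)
      fix e :: real assume "e > 0"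
      \<comment> \<open>As \<open>h\<close> equals \<open>a\<close> plus the argument of the
        quotient, and the quotient tends to 1 whose argument is 0, the limit of \<open>h\<close> at
        the ray is \<open>a\<close>.\<close>
      have "isCont Arg 1" by (intro continuous_at_Arg) auto
      then obtain d where d: "d > 0" "\<And>w. dist w 1 < d \<Longrightarrow> dist (Arg w) (Arg 1) < e"
        using \<open>e > 0\<close> unfolding continuous_at_eps_delta by (metis dist_commute)
      obtain \<epsilon> where \<epsilon>: "\<epsilon> > 0" "\<forall>x\<in>ray_nhd p \<theta> \<epsilon>. dist (g x / g t) 1 < d" using near[OF d(1)] by blast
      let ?T = "ray_nhd p \<theta> (min \<delta> \<epsilon>)"
      have "dist (f x) a < e" if x: "x \<in> ?T" "x \<in> ?S" for x
      proof -
        obtain z where z: "x = Pt z" using x by blast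
        have "x \<in> ray_nhd p \<theta> \<delta>" "x \<in> ray_nhd p \<theta> \<epsilon>"
          using x by (auto simp: z Pt_mem_ray_nhd)
        then have "f x - a = Arg (g x / g t)" "dist (Arg (g x / g t)) (Arg 1) < e"
          using a[of z] \<epsilon>(2) d(2) by (auto simp: f_def z)
        then show ?thesis by (simp add: dist_real_def)
      qed
      moreover have "t \<in> ?T" using t \<delta> \<epsilon> by (simp add: Ray_mem_ray_nhd)
      ultimately show "\<forall>\<^sub>F x in atin_within bordered_prufer t ?S. dist (f x) a < e"
        unfolding eventually_atin_within
        using openin_ray_nhd[of p \<theta> "min \<delta> \<epsilon>"] by (intro disjI2 exI[of _ ?T]) auto
    qed
    then show ?thesis by blast
  qed
  \<comment> \<open>A continuous map from a dense subset into a regular space extends continuously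
    once it has a limit at each remaining point.\<close>
  obtain k where k: "continuous_map (subtopology bordered_prufer bordered_points) euclideanreal k"
    "\<And>x. x \<in> ?S \<Longrightarrow> k x = f x"
  proof (rule continuous_map_extension_pointwise_alt[OF _ _ _ f lim])
    show "regular_space euclideanreal"
      by (simp add: regular_space_euclidean)
    show "?S \<subseteq> bordered_points" by (auto simp: Pt_mem_bordered)
  qed (auto simp: closure_of_Pt)
  then have k1: "continuous_map bordered_prufer euclideanreal k"
    by (metis subtopology_topspace topspace_bordered_prufer)
  have "g x = cis (k x)" if "x \<in> bordered_points" for x
  proof (rule forall_in_closure_of_eq[where f = g and g = "\<lambda>x. cis (k x)" and Y = circle])
    show "x \<in> bordered_prufer closure_of ?S" using that by (simp add: closure_of_Pt)
    show "continuous_map bordered_prufer circle (\<lambda>x. cis (k x))" using k1 by (rule continuous_map_cis)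
    show "Hausdorff_space circle" by (simp add: Hausdorff_space_subtopology)
    show "g x = cis (k x)" if "x \<in> ?S" for x
      using that h(2) k(2)[OF that] by (auto simp: f_def)
  qed (rule g)
  with k1 show ?thesis using that by blast
qed

section \<open>The Pruefer surface and its loops\<close>

text \<open>This is the universal property of the quotient topology; applied to the identity of the
  double it also yields continuity of the two embeddings.\<close>

lemma continuous_map_double_iff:
  "continuous_map (double_topology X A) Y F \<longleftrightarrow> (\<forall>b. continuous_map X Y (F \<circ> glue A b))"
proof -
  have "double_open X A {y \<in> \<Union>b. glue A b ` topspace X. F y \<in> U} \<longleftrightarrow>
      (\<forall>b. openin X {x \<in> topspace X. F (glue A b x) \<in> U})" for U
  proof -
    have "{x \<in> topspace X. glue A b x \<in> {y \<in> \<Union>b. glue A b ` topspace X. F y \<in> U}} =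
        {x \<in> topspace X. F (glue A b x) \<in> U}" for b
      by auto
    then show ?thesis unfolding double_open_def by auto
  qed
  then show ?thesis
    unfolding continuous_map_def topspace_double_topology openin_double_topology
    by (fastforce simp: o_def)
qed

lemma continuous_map_glue: "continuous_map X (double_topology X A) (glue A b)"
  using continuous_map_double_iff[of X A "double_topology X A" "\<lambda>x. x"] by (simp add: o_def)

lemma continuous_map_glue_prufer: "continuous_map bordered_prufer prufer (glue boundary_rays b)"
  unfolding prufer_def by (rule continuous_map_glue)

lemma prufer_pointE:
  assumes "y \<in> topspace prufer"
  obtains x b where "x \<in> bordered_points" "y = glue boundary_rays b x"
  using assms by (auto simp: prufer_def topspace_double_topology topspace_bordered_prufer)

text \<open>The planar formula for the semicircle without the case distinction at its ends. It is
  continuous in all real \<open>s\<close>, so limits at the end points can be computed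
  analytically.\<close>

definition semicircle_point :: "real \<Rightarrow> real \<Rightarrow> complex" where
  "semicircle_point t s = Complex (t / 2 - t / 2 * cos (pi * s)) (\<bar>t\<bar> / 2 * sin (pi * s))"

lemma semicircle_eq:
  "semicircle t s = (if s \<le> 0 then vertical_ray 0 else if s \<ge> 1 then vertical_ray t
     else Pt (semicircle_point t s))"
  by (simp add: semicircle_def semicircle_point_def)

lemma Im_semicircle_point: "\<lbrakk>t \<noteq> 0; 0 < s; s < 1\<rbrakk> \<Longrightarrow> Im (semicircle_point t s) > 0"
  by (simp add: semicircle_point_def sin_gt_zero)

text \<open>Seen from \<open>t\<close> and run backwards, the semicircle is the one belonging to
  \<open>- t\<close>. The end at \<open>t\<close> thus reduces to the start at 0.\<close>

lemma semicircle_point_reflect: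
  "semicircle_point t s - of_real t = semicircle_point (- t) (1 - s)"
  by (simp add: semicircle_point_def complex_eq_iff right_diff_distrib cos_diff sin_diff)

lemma continuous_semicircle_point: "continuous_on S (semicircle_point t)"
  unfolding semicircle_point_def Complex_eq by (intro continuous_intros)


text \<open>The half-angle formula splits off a positive factor carrying all the decay at
  \<open>s = 0\<close>. The remaining vector tends to a vertical one, so the direction of approach
  can be read off.\<close>

lemma semicircle_point_tan:
  assumes "0 < s" "s < 1"
  shows "semicircle_point t s = of_real (sin (pi * s)) * Complex (t / 2 * tan (pi * s / 2)) (\<bar>t\<bar> / 2)"
proof -
  have "cos (pi * s / 2) > 0"
    using assms by (intro cos_gt_zero) auto
  moreover have "sin (pi * s) = 2 * sin (pi * s / 2) * cos (pi * s / 2)"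
    "cos (pi * s) = 1 - 2 * (sin (pi * s / 2))\<^sup>2"
    using sin_double[of "pi * s / 2"] cos_double_sin[of "pi * s / 2"] by simp_all
  ultimately have "1 - cos (pi * s) = sin (pi * s) * tan (pi * s / 2)"
    by (simp add: tan_def power2_eq_square)
  moreover have "t / 2 - t / 2 * cos (pi * s) = t / 2 * (1 - cos (pi * s))"
    by (simp add: algebra_simps)
  ultimately show ?thesis
    by (simp add: semicircle_point_def complex_eq_iff)
qed

lemma semicircle_point_near_0:
  assumes "t \<noteq> 0" "\<epsilon> > 0"
  obtains d where "0 < d" "d < 1"
    "\<And>s. \<lbrakk>0 < s; s < d\<rbrakk> \<Longrightarrow> cmod (semicircle_point t s) < \<epsilon> \<and> \<bar>Arg (semicircle_point t s) - pi / 2\<bar> < \<epsilon>"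
proof -
  \<comment> \<open>For small positive \<open>s\<close>, \<open>w s\<close> has the same argument as
    the point on the semicircle; unlike that point it does not vanish at 0, so \<open>Arg\<close>
    can be evaluated in the limit.\<close>
  define w where "w s = Complex (t / 2 * tan (pi * s / 2)) (\<bar>t\<bar> / 2)" for s
  have w0: "w 0 = of_real (\<bar>t\<bar> / 2) * \<i>" by (simp add: w_def complex_eq_iff)
  have "Arg (w 0) = pi / 2" unfolding w0 by (subst Arg_times_of_real) (use assms in auto)
  moreover have "isCont w 0" unfolding w_def Complex_eq by (intro continuous_intros) auto
  then have "isCont (\<lambda>s. Arg (w s)) 0"
    by (rule isCont_o2) (rule continuous_at_Arg, use assms in \<open>simp add: w_def complex_nonpos_Reals_iff\<close>)
  ultimately have "((\<lambda>s. Arg (w s)) \<longlongrightarrow> pi / 2) (at 0)" unfolding isCont_def by metis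
  then have "\<forall>\<^sub>F s in at 0. dist (Arg (w s)) (pi / 2) < \<epsilon>" using assms(2) by (rule tendstoD)
  moreover have "isCont (semicircle_point t) 0"
    using continuous_semicircle_point[of UNIV] by (simp add: continuous_on_eq_continuous_at)
  then have "(semicircle_point t \<longlongrightarrow> 0) (at 0)"
    by (simp add: isCont_def semicircle_point_def Complex_eq)
  then have "\<forall>\<^sub>F s in at 0. dist (semicircle_point t s) 0 < \<epsilon>" using assms(2) by (rule tendstoD)
  ultimately have "\<forall>\<^sub>F s in at 0. dist (Arg (w s)) (pi / 2) < \<epsilon> \<and> dist (semicircle_point t s) 0 < \<epsilon>"
    by (rule eventually_conj)
  then obtain d where d: "d > 0"
    "\<And>s. \<lbrakk>s \<noteq> 0; dist s 0 < d\<rbrakk> \<Longrightarrow> dist (Arg (w s)) (pi / 2) < \<epsilon> \<and> dist (semicircle_point t s) 0 < \<epsilon>"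
    by (auto simp: eventually_at)
  show ?thesis
  proof (rule that[of "min d (1/2)"])
    fix s :: real assume s: "0 < s" "s < min d (1 / 2)"
    then have "Arg (semicircle_point t s) = Arg (w s)"
      unfolding w_def by (subst semicircle_point_tan) (auto simp: Arg_times_of_real sin_gt_zero)
    then show "cmod (semicircle_point t s) < \<epsilon> \<and> \<bar>Arg (semicircle_point t s) - pi / 2\<bar> < \<epsilon>"
      using d(2)[of s] s by (auto simp: dist_real_def)
  qed (use d in auto)
qed

lemma pathin_semicircle:
  assumes t: "t \<noteq> 0"
  shows "pathin bordered_prufer (semicircle t)"
  unfolding pathin_def continuous_map_def
proof (intro conjI allI impI)
  show "semicircle t \<in> topspace (top_of_set {0..1}) \<rightarrow> topspace bordered_prufer"
    using Im_semicircle_point[OF t]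
    by (auto simp: semicircle_eq topspace_bordered_prufer vertical_ray_def Ray_mem_bordered Pt_mem_bordered)
next
  fix U assume "openin bordered_prufer U"
  then have U: "bordered_open U" by (simp add: openin_bordered_prufer)
  let ?W = "{s \<in> topspace (top_of_set {0..1}). semicircle t s \<in> U}"
  have "\<exists>e>0. \<forall>s'\<in>{0..1}. dist s' s < e \<longrightarrow> s' \<in> ?W" if s_in: "s \<in> ?W" for s
  proof -
    consider "s = 0" | "s = 1" | "0 < s" "s < 1" using s_in by fastforce
    then show ?thesis
    proof cases
      case 1
      then have "Ray 0 (pi / 2) \<in> U" using s_in by (simp add: semicircle_eq vertical_ray_def)
      then obtain \<epsilon> where \<epsilon>: "\<epsilon> > 0" "ray_nhd 0 (pi / 2) \<epsilon> \<subseteq> U"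
        using U unfolding bordered_open_def by metis
      obtain d where d: "0 < d" "d < 1"
        "\<And>s. \<lbrakk>0 < s; s < d\<rbrakk> \<Longrightarrow> cmod (semicircle_point t s) < \<epsilon> \<and> \<bar>Arg (semicircle_point t s) - pi / 2\<bar> < \<epsilon>"
        using semicircle_point_near_0[OF t \<epsilon>(1)] by blast
      have "semicircle t s' \<in> U" if "s' \<in> {0..1}" "dist s' s < d" for s'
      proof (cases "s' = 0")
        case True
        then show ?thesis using s_in 1 by simp
      next
        case False
        then have s': "0 < s'" "s' < d" "s' < 1" using that 1 d(2) by (auto simp: dist_real_def)
        then have "Pt (semicircle_point t s') \<in> ray_nhd 0 (pi / 2) \<epsilon>"
          using d(3)[OF s'(1,2)] Im_semicircle_point[OF t s'(1,3)] by (simp add: Pt_mem_ray_nhd)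
        then show ?thesis using \<epsilon>(2) s' by (auto simp: semicircle_eq)
      qed
      then show ?thesis using d(1) by auto
    next
      case 2
      then have "Ray t (pi / 2) \<in> U" using s_in by (simp add: semicircle_eq vertical_ray_def)
      then obtain \<epsilon> where \<epsilon>: "\<epsilon> > 0" "ray_nhd t (pi / 2) \<epsilon> \<subseteq> U"
        using U unfolding bordered_open_def by metis
      obtain d where d: "0 < d" "d < 1"
        "\<And>s. \<lbrakk>0 < s; s < d\<rbrakk> \<Longrightarrow>
          cmod (semicircle_point (- t) s) < \<epsilon> \<and> \<bar>Arg (semicircle_point (- t) s) - pi / 2\<bar> < \<epsilon>"
        using semicircle_point_near_0[of "- t" \<epsilon>] t \<epsilon>(1) by (metis neg_equal_0_iff_equal)
      have "semicircle t s' \<in> U" if "s' \<in> {0..1}" "dist s' s < d" for s'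
      proof (cases "s' = 1")
        case True
        then show ?thesis using s_in 2 by simp
      next
        case False
        then have s': "0 < 1 - s'" "1 - s' < d" "0 < s'" "s' < 1"
          using that 2 d(2) by (auto simp: dist_real_def)
        then have "Pt (semicircle_point t s') \<in> ray_nhd t (pi / 2) \<epsilon>"
          using d(3)[OF s'(1,2)] Im_semicircle_point[OF t s'(3,4)]
          by (simp add: Pt_mem_ray_nhd semicircle_point_reflect)
        then show ?thesis using \<epsilon>(2) s' by (auto simp: semicircle_eq)
      qed
      then show ?thesis using d(1) by auto
    next
      case 3
      have "open {z. Pt z \<in> U}" using U by (simp add: bordered_open_def)
      then have "open ({0<..<1} \<inter> semicircle_point t -` {z. Pt z \<in> U})"
        by (intro continuous_open_preimage continuous_semicircle_point) auto
      moreover have "s \<in> {0<..<1} \<inter> semicircle_point t -` {z. Pt z \<in> U}"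
        using 3 s_in by (auto simp: semicircle_eq)
      ultimately obtain e where "e > 0" "ball s e \<subseteq> {0<..<1} \<inter> semicircle_point t -` {z. Pt z \<in> U}"
        using open_contains_ball by metis
      then show ?thesis
        by (intro exI[of _ e]) (auto simp: semicircle_eq subset_iff dist_commute)
    qed
  qed
  then show "openin (top_of_set {0..1}) ?W"
    unfolding openin_euclidean_subtopology_iff by auto
qed

lemma pathin_reverse:
  assumes "pathin X p" shows "pathin X (\<lambda>s. p (1 - s))"
  unfolding pathin_def
  by (rule continuous_map_compose[where g=p, unfolded o_def, OF _ assms[unfolded pathin_def]])
     (auto intro!: continuous_intros)

text \<open>The halves run in different copies; they meet over \<open>t\<close> and close up over 0
  because \<open>glue\<close> ignores the copy label on boundary rays.\<close>

lemma alpha_loop: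
  assumes "t \<noteq> 0"
  shows "alpha t \<in> loops_at prufer prufer_base"
proof -
  have "pathin prufer (glue boundary_rays b \<circ> semicircle t)" for b
    using pathin_semicircle[OF assms] continuous_map_glue_prufer by (rule pathin_compose)
  from pathin_join[OF this[of False] pathin_reverse[OF this[of True]]]
  have "pathin prufer (alpha t)"
    by (simp add: alpha_def semicircle_eq glue_def vertical_ray_def Ray_mem_boundary)
  then show ?thesis
    by (auto simp: loops_at_def alpha_def path_join_def prufer_base_def semicircle_eq glue_def
        vertical_ray_def Ray_mem_boundary)
qed

text \<open>\<open>h b\<close> lifts a circle-valued map on copy \<open>b\<close>; the two lifts differ over the boundary line
  \<open>p\<close> by \<open>n p\<close> full turns.\<close>

definition lift_pair ::
    "(bordered_point \<times> bool \<Rightarrow> complex) \<Rightarrow> (bool \<Rightarrow> bordered_point \<Rightarrow> real) \<Rightarrow> (real \<Rightarrow> int) \<Rightarrow> bool" where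
  "lift_pair g h n \<longleftrightarrow> (\<forall>b. continuous_map bordered_prufer euclideanreal (h b)) \<and>
     (\<forall>b. \<forall>x\<in>bordered_points. g (glue boundary_rays b x) = cis (h b x)) \<and>
     (\<forall>p \<theta>. 0 < \<theta> \<longrightarrow> \<theta> < pi \<longrightarrow> h False (Ray p \<theta>) - h True (Ray p \<theta>) = 2 * pi * of_int (n p))"

lemma lift_pair_exists:
  assumes g: "continuous_map prufer circle g"
  obtains h n where "lift_pair g h n"
proof -
  have "\<exists>h. continuous_map bordered_prufer euclideanreal h \<and>
      (\<forall>x\<in>bordered_points. g (glue boundary_rays b x) = cis (h x))" for b
    using bordered_lift[OF continuous_map_compose[OF continuous_map_glue_prufer g], of b]
    by (metis comp_apply)
  then obtain h where h: "\<And>b. continuous_map bordered_prufer euclideanreal (h b)"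
    "\<And>b x. x \<in> bordered_points \<Longrightarrow> g (glue boundary_rays b x) = cis (h b x)"
    by metis
  have "\<exists>n::int. \<forall>\<theta>. 0 < \<theta> \<longrightarrow> \<theta> < pi \<longrightarrow>
      h False (Ray p \<theta>) - h True (Ray p \<theta>) = 2 * pi * of_int n" for p
  proof -
    have cis_eq: "cis (h False (Ray p \<theta>)) = cis (h True (Ray p \<theta>))" if "\<theta> \<in> {0<..<pi}" for \<theta>
      using h(2)[of "Ray p \<theta>" True] h(2)[of "Ray p \<theta>" False] that
      by (simp add: Ray_mem_bordered glue_def Ray_mem_boundary)
    have cont: "continuous_on {0<..<pi} (\<lambda>\<theta>. h b (Ray p \<theta>))" for b
      unfolding continuous_on_iff
    proof (intro ballI allI impI)
      fix \<theta> e :: real assume "\<theta> \<in> {0<..<pi}" "e > 0"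
      then obtain \<epsilon> where "\<epsilon> > 0" "\<forall>x\<in>ray_nhd p \<theta> \<epsilon>. dist (h b x) (h b (Ray p \<theta>)) < e"
        using h(1)[of b] unfolding continuous_map_bordered_iff by (metis greaterThanLessThan_iff)
      then show "\<exists>d>0. \<forall>\<phi>\<in>{0<..<pi}. dist \<phi> \<theta> < d \<longrightarrow> dist (h b (Ray p \<phi>)) (h b (Ray p \<theta>)) < e"
        by (auto simp: Ray_mem_ray_nhd dist_real_def)
    qed
    have d1: "continuous_on {0<..<pi} (\<lambda>\<theta>. h False (Ray p \<theta>) - h True (Ray p \<theta>))"
      by (intro continuous_intros cont)
    have d2: "cis (h False (Ray p \<theta>) - h True (Ray p \<theta>)) = 1" if "\<theta> \<in> {0<..<pi}" for \<theta>
      using cis_eq[OF that] by (simp flip: cis_divide)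
    obtain a where a: "\<And>\<theta>. \<theta> \<in> {0<..<pi} \<Longrightarrow> h False (Ray p \<theta>) - h True (Ray p \<theta>) = a"
      by (rule cis_constant_imp_constant[OF connected_Ioo d1 d2]) (assumption, blast)
    obtain n :: int where "h False (Ray p (pi / 2)) - h True (Ray p (pi / 2)) = 2 * pi * of_int n"
      using cis_eq_imp[OF cis_eq[of "pi / 2"]] by auto
    then show ?thesis using a a[of "pi / 2"] by (intro exI[of _ n]) auto
  qed
  then obtain n :: "real \<Rightarrow> int" where "\<And>p \<theta>. 0 < \<theta> \<Longrightarrow> \<theta> < pi \<Longrightarrow>
      h False (Ray p \<theta>) - h True (Ray p \<theta>) = 2 * pi * of_int (n p)"
    by metis
  with h show ?thesis using that unfolding lift_pair_def by blast
qed

lemma cis_add_2pi: "cis (a + 2 * pi * of_int k) = cis a"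
  by (metis cis_mult cis_multiple_2pi Ints_of_int mult.right_neutral)

text \<open>Raising the second lift by \<open>n t\<close> turns makes it agree with the first at the
  vertical ray over \<open>t\<close>, so the two join to a lift along the loop. Back over 0, the
  second lift lies \<open>n 0\<close> turns below the first, which leaves \<open>n t - n 0\<close>
  turns in all.\<close>

lemma circle_degree_alpha:
  assumes "lift_pair g h n" "t \<noteq> 0"
  shows "circle_degree (g \<circ> alpha t) = n t - n 0"
proof -
  have h: "\<And>b. continuous_map bordered_prufer euclideanreal (h b)"
    "\<And>b x. x \<in> bordered_points \<Longrightarrow> g (glue boundary_rays b x) = cis (h b x)"
    and n: "\<And>p \<theta>. 0 < \<theta> \<Longrightarrow> \<theta> < pi \<Longrightarrow>
      h False (Ray p \<theta>) - h True (Ray p \<theta>) = 2 * pi * of_int (n p)"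
    using assms(1) unfolding lift_pair_def by blast+
  have sc: "semicircle t s \<in> bordered_points" for s
    using Im_semicircle_point[OF assms(2), of s]
    by (auto simp: semicircle_eq vertical_ray_def Ray_mem_bordered Pt_mem_bordered)
  let ?H = "path_join (h False \<circ> semicircle t) (\<lambda>s. h True (semicircle t (1 - s)) + 2 * pi * of_int (n t))"
  have p: "pathin euclideanreal (h b \<circ> semicircle t)" for b
    using pathin_semicircle[OF assms(2)] h(1) by (rule pathin_compose)
  have "pathin euclideanreal ?H"
  proof (rule pathin_join[OF p])
    show "pathin euclideanreal (\<lambda>s. h True (semicircle t (1 - s)) + 2 * pi * of_int (n t))"
      using pathin_reverse[OF p[of True]] by (auto simp: pathin_def intro!: continuous_intros)
    show "(h False \<circ> semicircle t) 1 = h True (semicircle t (1 - 0)) + 2 * pi * of_int (n t)"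
      using n[of "pi / 2" t] by (simp add: semicircle_eq vertical_ray_def)
  qed
  then have "continuous_on {0..1} ?H" by (simp add: pathin_def)
  moreover have "(g \<circ> alpha t) s = cis (?H s)" for s
    using h(2)[OF sc] by (simp add: alpha_def path_join_def cis_add_2pi)
  moreover have "?H 1 - ?H 0 = 2 * pi * of_int (n t - n 0)"
    using n[of "pi / 2" 0] by (simp add: path_join_def semicircle_eq vertical_ray_def algebra_simps)
  ultimately show ?thesis by (intro circle_degree_lift[of ?H]) auto
qed

section \<open>Homotopies between maps with equal degrees\<close>

lemma nullhomotopic_twist:
  assumes "continuous_map X circle g" "continuous_map X euclideanreal H"
    and "\<And>x. x \<in> topspace X \<Longrightarrow> f x = g x * cis (H x)"
  shows "homotopic_with (\<lambda>_. True) X circle g f"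
proof -
  let ?k = "\<lambda>z. g (snd z) * cis (fst z * H (snd z))"
  have "continuous_map (prod_topology (top_of_set {0..1::real}) X) circle ?k"
    using continuous_map_compose[OF continuous_map_snd assms(1), of "top_of_set {0..1}"]
      continuous_map_compose[OF continuous_map_snd assms(2), of "top_of_set {0..1}"]
    by (intro continuous_map_circle_mult continuous_map_cis continuous_map_real_mult
        continuous_map_into_fulltopology[OF continuous_map_fst]) (auto simp: o_def)
  then have "homotopic_with (\<lambda>_. True) X circle (\<lambda>x. ?k (0, x)) (\<lambda>x. ?k (1, x))"
    unfolding homotopic_with_def by (intro exI[of _ ?k]) auto
  then show ?thesis
    by (rule homotopic_with_eq) (use assms(3) in auto)
qed

lemma continuous_map_prufer_glued:
  assumes h: "\<And>b. continuous_map bordered_prufer Y (h b)"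
    and eq: "\<And>x. x \<in> boundary_rays \<Longrightarrow> h True x = h False x"
  shows "continuous_map prufer Y (\<lambda>y. h (snd y) (fst y))"
  unfolding prufer_def continuous_map_double_iff
proof
  fix b
  have "h (snd (glue boundary_rays b x)) (fst (glue boundary_rays b x)) = h b x" for x
    using eq[of x] by (cases b; cases "x \<in> boundary_rays") (auto simp: glue_def)
  then have "(\<lambda>y. h (snd y) (fst y)) \<circ> glue boundary_rays b = h b" by auto
  then show "continuous_map bordered_prufer Y ((\<lambda>y. h (snd y) (fst y)) \<circ> glue boundary_rays b)"
    using h by simp
qed

lemma homotopic_of_equal_degrees:
  assumes f: "continuous_map prufer circle f" and g: "continuous_map prufer circle g"
    and deg: "\<And>t. t \<noteq> 0 \<Longrightarrow> circle_degree (f \<circ> alpha t) = circle_degree (g \<circ> alpha t)"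
  shows "homotopic_with (\<lambda>_. True) prufer circle g f"
proof -
  obtain h n where "lift_pair f h n" using lift_pair_exists[OF f] .
  obtain k m where "lift_pair g k m" using lift_pair_exists[OF g] .
  have nm: "n t - m t = n 0 - m 0" for t
    using circle_degree_alpha[OF \<open>lift_pair f h n\<close>] circle_degree_alpha[OF \<open>lift_pair g k m\<close>] deg[of t]
    by (cases "t = 0") auto
  \<comment> \<open>Over the line at \<open>p\<close> the difference of lifts on the first copy
    exceeds that on the second by \<open>n p - m p\<close> turns. This number is the same for all
    \<open>p\<close>, so one constant shift closes the gap on every line.\<close>
  define H where "H b x = h b x - k b x + (if b then 2 * pi * of_int (n 0 - m 0) else 0)" for b x
  show ?thesis
  proof (rule nullhomotopic_twist[OF g])
    show "continuous_map prufer euclideanreal (\<lambda>y. H (snd y) (fst y))"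
    proof (rule continuous_map_prufer_glued)
      show "continuous_map bordered_prufer euclideanreal (H b)" for b
        unfolding H_def using \<open>lift_pair f h n\<close> \<open>lift_pair g k m\<close>
        by (intro continuous_intros) (auto simp: lift_pair_def)
      fix x assume "x \<in> boundary_rays"
      then obtain p \<theta> where x: "x = Ray p \<theta>" "0 < \<theta>" "\<theta> < pi" by (auto simp: boundary_rays_def)
      then have "h False x - h True x = 2 * pi * of_int (n p)" "k False x - k True x = 2 * pi * of_int (m p)"
        using \<open>lift_pair f h n\<close> \<open>lift_pair g k m\<close> by (auto simp: lift_pair_def)
      then have "(h False x - k False x) - (h True x - k True x) = 2 * pi * of_int (n p - m p)"
        by (simp add: algebra_simps)
      then show "H True x = H False x" unfolding nm[of p] by (simp add: H_def)
    qed
    fix y assume "y \<in> topspace prufer"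
    then obtain x b where xb: "x \<in> bordered_points" "y = glue boundary_rays b x" by (rule prufer_pointE)
    \<comment> \<open>On a boundary ray \<open>b\<close> may be \<open>True\<close> although the
      label of \<open>y\<close> is \<open>False\<close>; \<open>c\<close> is the label that the
      formula for \<open>H\<close> sees.\<close>
    define c where "c = snd y"
    have y: "y = glue boundary_rays c x" "fst y = x" by (auto simp: c_def xb glue_def)
    have fg: "f y = cis (h c x)" "g y = cis (k c x)"
      using \<open>lift_pair f h n\<close> \<open>lift_pair g k m\<close> xb(1) by (auto simp: y(1) lift_pair_def)
    have "cis (H c x) = cis (h c x - k c x)"
      using cis_add_2pi[of _ "n 0 - m 0"] by (simp add: H_def)
    then show "f y = g y * cis (H (snd y) (fst y))"
      unfolding fg y(2) c_def[symmetric] by (simp add: cis_mult)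
  qed
qed

section \<open>Integer-valued Baire-1 functions\<close>

text \<open>Distinct integers are at distance at least 1, so the limit is \<open>k\<close> exactly
  if the sequence stays within 1/3 of \<open>k\<close> from some index on. The nonstrict inequality
  makes the set belonging to each starting index closed.\<close>

lemma fsigma_fibre_of_limit:
  fixes u :: "nat \<Rightarrow> 'a::topological_space \<Rightarrow> real" and n :: "'a \<Rightarrow> int"
  assumes u: "\<And>m. continuous_on UNIV (u m)" and lim: "\<And>p. (\<lambda>m. u m p) \<longlonglongrightarrow> of_int (n p)"
  shows "fsigma_in euclidean {p. n p = k}"
proof -
  let ?C = "\<lambda>M. \<Inter>m\<in>{M..}. {p. \<bar>u m p - of_int k\<bar> \<le> 1/3}"
  have "{p. n p = k} = (\<Union>M. ?C M)"
  proof (intro equalityI subsetI)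
    fix p assume "p \<in> {p. n p = k}"
    then have "\<forall>\<^sub>F m in sequentially. dist (u m p) (of_int k) < 1/3"
      using lim[of p] by (intro tendstoD) auto
    then obtain M where "\<And>m. m \<ge> M \<Longrightarrow> dist (u m p) (of_int k) < 1/3"
      by (auto simp: eventually_sequentially)
    then have "p \<in> ?C M" by (force simp: dist_real_def)
    then show "p \<in> (\<Union>M. ?C M)" by blast
  next
    fix p assume "p \<in> (\<Union>M. ?C M)"
    then obtain M where "\<And>m. m \<ge> M \<Longrightarrow> \<bar>u m p - of_int k\<bar> \<le> 1/3" by auto
    then have "\<bar>of_int (n p) - of_int k\<bar> \<le> (1/3::real)"
      by (intro tendsto_upperbound[OF tendsto_rabs[OF tendsto_diff[OF lim tendsto_const]]])
         (auto simp: eventually_sequentially)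
    then have "\<bar>real_of_int (n p - k)\<bar> < 1" by simp
    then show "p \<in> {p. n p = k}" unfolding mem_Collect_eq by linarith
  qed
  moreover have "closed (?C M)" for M
    by (intro closed_INT ballI closed_Collect_le continuous_intros u)
  then have "fsigma_in euclidean (\<Union>M. ?C M)"
    by (intro fsigma_in_Union) (auto simp only: closed_closedin intro!: closed_imp_fsigma_in)
  ultimately show ?thesis by simp
qed

text \<open>Every preimage is a union of fibres, and a countable one because the type of values is
  countable.\<close>

lemma baire1_discrete_iff:
  fixes f :: "'a \<Rightarrow> 'b::countable"
  shows "baire1 X (discrete_topology UNIV) f \<longleftrightarrow> (\<forall>k. fsigma_in X {x \<in> topspace X. f x = k})"
proof (intro iffI allI)
  fix k assume "baire1 X (discrete_topology UNIV) f"
  then have "fsigma_in X {x \<in> topspace X. f x \<in> {k}}"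
    unfolding baire1_def by (metis openin_discrete_topology subset_UNIV)
  then show "fsigma_in X {x \<in> topspace X. f x = k}" by simp
next
  assume L: "\<forall>k. fsigma_in X {x \<in> topspace X. f x = k}"
  have "{x \<in> topspace X. f x \<in> U} = (\<Union>k\<in>U. {x \<in> topspace X. f x = k})" for U
    by auto
  moreover have "fsigma_in X (\<Union>k\<in>U. {x \<in> topspace X. f x = k})" for U
    using L by (intro fsigma_in_Union) auto
  ultimately show "baire1 X (discrete_topology UNIV) f"
    by (simp add: baire1_def)
qed

lemma lift_pair_fsigma:
  assumes "lift_pair g h n"
  shows "fsigma_in euclidean {p. n p = k}"
proof (rule fsigma_fibre_of_limit)
  let ?z = "\<lambda>m p. Complex p (1 / Suc m)"
  let ?d = "\<lambda>x. h False x - h True x"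
  have h: "continuous_map bordered_prufer euclideanreal ?d"
    using assms unfolding lift_pair_def by (intro continuous_intros) auto
  then have c: "continuous_on upper_half (?d \<circ> Pt)"
    unfolding continuous_map_bordered_iff by blast
  show "continuous_on UNIV (\<lambda>p. ?d (Pt (?z m p)) / (2 * pi))" for m
    by (intro continuous_intros continuous_on_compose2[OF c[unfolded o_def]])
       (auto simp: Complex_eq intro!: continuous_intros)
  fix p
  have "(\<lambda>m. ?d (Pt (?z m p))) \<longlonglongrightarrow> ?d (Ray p (pi / 2))"
  proof (rule tendstoI)
    fix e :: real assume "e > 0"
    moreover have "0 < pi / 2" "pi / 2 < pi" by auto
    ultimately obtain \<epsilon> where \<epsilon>: "\<epsilon> > 0" "\<And>x. x \<in> ray_nhd p (pi / 2) \<epsilon> \<Longrightarrow> dist (?d x) (?d (Ray p (pi / 2))) < e"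
      using h unfolding continuous_map_bordered_iff by meson
    have "\<forall>\<^sub>F m in sequentially. 1 / Suc m < \<epsilon>"
      using order_tendstoD(2)[OF LIMSEQ_inverse_real_of_nat \<epsilon>(1)] by (simp add: inverse_eq_divide)
    then show "\<forall>\<^sub>F m in sequentially. dist (?d (Pt (?z m p))) (?d (Ray p (pi / 2))) < e"
    proof (rule eventually_mono)
      fix m assume m: "1 / Suc m < \<epsilon>"
      \<comment> \<open>The points approach \<open>p\<close> on the vertical ray itself, so the
        angle condition holds without error and only the distance must become small.\<close>
      have w: "?z m p - of_real p = of_real (1 / Suc m) * \<i>" by (simp add: complex_eq_iff)
      have "Arg (?z m p - of_real p) = pi / 2"
        unfolding w by (subst Arg_times_of_real) auto
      moreover have "cmod (?z m p - of_real p) = 1 / Suc m"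
        unfolding w norm_mult norm_of_real by simp
      ultimately show "dist (?d (Pt (?z m p))) (?d (Ray p (pi / 2))) < e"
        using m \<epsilon> by (intro \<epsilon>(2)) (simp add: Pt_mem_ray_nhd)
    qed
  qed
  moreover have "?d (Ray p (pi / 2)) = 2 * pi * of_int (n p)"
    using assms by (simp add: lift_pair_def)
  ultimately have "(\<lambda>m. ?d (Pt (?z m p)) / (2 * pi)) \<longlonglongrightarrow> 2 * pi * of_int (n p) / (2 * pi)"
    by (intro tendsto_divide tendsto_const) auto
  then show "(\<lambda>m. ?d (Pt (?z m p)) / (2 * pi)) \<longlonglongrightarrow> of_int (n p)" by simp
qed

text \<open>Each fibre is a countable union of closed sets. On a finite union of such sets
  \<open>n\<close> is continuous, being constant on each closed piece, and Tietze extends it to the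
  line. Every \<open>p\<close> lies in all sufficiently large finite unions, whence equality rather
  than mere convergence.\<close>

lemma eventually_exact_approximation:
  fixes n :: "real \<Rightarrow> int"
  assumes n: "\<And>k. fsigma_in euclidean {p. n p = k}"
  obtains \<phi> :: "nat \<Rightarrow> real \<Rightarrow> real" where "\<And>m. continuous_on UNIV (\<phi> m)"
    "\<And>p. \<exists>M. \<forall>m\<ge>M. \<phi> m p = of_int (n p)"
proof -
  have "\<exists>C::nat \<Rightarrow> real set. (\<forall>i. closed (C i)) \<and> \<Union>(range C) = {p. n p = k}" for k
    using n[of k] unfolding fsigma_in_ascending closed_closedin by blast
  then obtain C :: "int \<Rightarrow> nat \<Rightarrow> real set" where C: "\<And>k i. closed (C k i)" "\<And>k. \<Union>(range (C k)) = {p. n p = k}"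
    by metis
  \<comment> \<open>One natural number encodes a value of \<open>n\<close> together with the index
    of a closed piece of its fibre.\<close>
  define E where "E j = C (int_decode (fst (prod_decode j))) (snd (prod_decode j))" for j
  let ?K = "\<lambda>m. \<Union>j\<in>{..m}. E j"
  have cE: "closed (E j)" for j by (simp add: E_def C)
  have cK: "continuous_on (?K m) (\<lambda>p. real_of_int (n p))" for m
  proof (rule continuous_on_closed_Union)
    fix j
    let ?k = "int_decode (fst (prod_decode j))"
    have "E j \<subseteq> {p. n p = ?k}"
      unfolding E_def C(2)[of ?k, symmetric] by (intro UN_upper UNIV_I)
    then have "real_of_int ?k = real_of_int (n x)" if "x \<in> E j" for x
      using that by auto
    then show "continuous_on (E j) (\<lambda>p. real_of_int (n p))"
      by (rule continuous_on_eq[OF continuous_on_const])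
  qed (auto simp: cE)
  have clK: "closedin (top_of_set UNIV) (?K m)" for m
    using cE by (simp add: closed_UN)
  have "\<exists>f. continuous_on UNIV f \<and> (\<forall>x\<in>?K m. f x = real_of_int (n x))" for m
    by (rule Tietze_unbounded[OF cK clK]) blast
  then obtain \<phi> where \<phi>: "\<And>m. continuous_on UNIV (\<phi> m)" "\<And>m x. x \<in> ?K m \<Longrightarrow> \<phi> m x = real_of_int (n x)"
    by metis
  have "\<exists>M. \<forall>m\<ge>M. \<phi> m p = of_int (n p)" for p
  proof -
    obtain i where "p \<in> C (n p) i" using C(2)[of "n p"] by blast
    then have "p \<in> E (prod_encode (int_encode (n p), i))" by (simp add: E_def)
    then show ?thesis using \<phi>(2) by (intro exI[of _ "prod_encode (int_encode (n p), i)"]) auto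
  qed
  with \<phi>(1) show ?thesis using that by blast
qed

text \<open>The window \<open>\<bar>p\<bar> \<le> real m\<close> eventually contains any given
  point, and the factor \<open>Suc m\<close> eventually exceeds the aperture of any given cone. Just
  two functions are controlled at stage \<open>m\<close> because only these are blended at heights
  between \<open>y (Suc m)\<close> and \<open>y m\<close>.\<close>

lemma scale_sequence:
  fixes \<phi> :: "nat \<Rightarrow> real \<Rightarrow> real"
  assumes \<phi>: "\<And>m. continuous_on UNIV (\<phi> m)"
  obtains y :: "nat \<Rightarrow> real" where "\<And>m. 0 < y m" "\<And>m. y m < 1 / Suc m" "\<And>m. 2 * y (Suc m) \<le> y m"
    "\<And>m p x k. \<lbrakk>\<bar>p\<bar> \<le> real m; \<bar>x - p\<bar> \<le> Suc m * y m; k \<in> {Suc m, Suc (Suc m)}\<rbrakk>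
      \<Longrightarrow> \<bar>\<phi> k x - \<phi> k p\<bar> \<le> 1 / Suc m"
proof -
  define P where "P m s \<longleftrightarrow> 0 < s \<and> s < 1 / Suc m \<and>
    (\<forall>p x. \<forall>k\<in>{Suc m, Suc (Suc m)}. \<bar>p\<bar> \<le> real m \<longrightarrow> \<bar>x - p\<bar> \<le> Suc m * s \<longrightarrow> \<bar>\<phi> k x - \<phi> k p\<bar> \<le> 1 / Suc m)"
    for m and s :: real
  have ex: "\<exists>s. P m s" for m
  proof -
    have "\<exists>d>0. \<forall>p x. \<bar>p\<bar> \<le> real m \<longrightarrow> \<bar>x - p\<bar> < d \<longrightarrow> \<bar>\<phi> k x - \<phi> k p\<bar> \<le> 1 / Suc m" for k
    proof -
      \<comment> \<open>The interval is longer by 1 on each side than the window for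
        \<open>p\<close>, leaving room for \<open>x\<close> when the modulus is at most 1.\<close>
      have "uniformly_continuous_on {- real (Suc m)..real (Suc m)} (\<phi> k)"
        by (intro compact_uniformly_continuous continuous_on_subset[OF \<phi>]) auto
      moreover have "1 / real (Suc m) > 0" by simp
      ultimately obtain d where d: "d > 0"
        "\<And>x p. \<lbrakk>x \<in> {- real (Suc m)..real (Suc m)}; p \<in> {- real (Suc m)..real (Suc m)}; dist x p < d\<rbrakk>
          \<Longrightarrow> dist (\<phi> k x) (\<phi> k p) < 1 / Suc m"
        unfolding uniformly_continuous_on_def by metis
      have "\<bar>\<phi> k x - \<phi> k p\<bar> \<le> 1 / Suc m" if "\<bar>p\<bar> \<le> real m" "\<bar>x - p\<bar> < min d 1" for p x
      proof -
        have "x \<in> {- real (Suc m)..real (Suc m)}" "p \<in> {- real (Suc m)..real (Suc m)}" "dist x p < d"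
          using that by (auto simp: abs_le_iff abs_less_iff dist_real_def)
        then show ?thesis using d(2)[of x p] by (simp add: dist_real_def)
      qed
      then show ?thesis using d(1) by (intro exI[of _ "min d 1"]) auto
    qed
    then obtain d where d: "\<And>k. d k > 0"
      "\<And>k p x. \<lbrakk>\<bar>p\<bar> \<le> real m; \<bar>x - p\<bar> < d k\<rbrakk> \<Longrightarrow> \<bar>\<phi> k x - \<phi> k p\<bar> \<le> 1 / Suc m"
      by metis
    define D where "D = min 1 (min (d (Suc m)) (d (Suc (Suc m))))"
    have D: "D > 0" "D \<le> 1" "D \<le> d (Suc m)" "D \<le> d (Suc (Suc m))" using d(1) by (auto simp: D_def)
    \<comment> \<open>Multiplied by \<open>Suc m\<close> this is \<open>D / 2\<close>, strictly
      below both moduli; since \<open>D \<le> 1\<close> it also lies below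
      \<open>1 / Suc m\<close>.\<close>
    let ?s = "D / (2 * Suc m)"
    have "?s = (D / 2) / Suc m" by simp
    then have "?s < 1 / Suc m" using D by (simp only:) (intro divide_strict_right_mono, auto)
    moreover have e: "real (Suc m) * ?s = D / 2" by (simp add: field_simps)
    moreover have "\<bar>\<phi> k x - \<phi> k p\<bar> \<le> 1 / Suc m"
      if "k \<in> {Suc m, Suc (Suc m)}" "\<bar>p\<bar> \<le> real m" "\<bar>x - p\<bar> \<le> D / 2" for k p x
      using that D by (intro d(2)) auto
    moreover have "0 < ?s" using D(1) by simp
    ultimately have "P m ?s" unfolding P_def e by blast
    then show ?thesis ..
  qed
  \<comment> \<open>As \<open>P\<close> passes to smaller positive scales, each new height can be
    taken at most half the preceding one.\<close>
  have smaller: "P m s'" if "P m s" "0 < s'" "s' \<le> s" for m s s'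
  proof -
    have "real (Suc m) * s' \<le> Suc m * s" using that(3) by (intro mult_left_mono) auto
    then show ?thesis using that unfolding P_def by (meson order_trans le_less_trans)
  qed
  have "\<exists>y. \<forall>m. P m (y m) \<and> 2 * y (Suc m) \<le> y m"
  proof (rule dependent_nat_choice)
    show "\<exists>s. P 0 s" by (rule ex)
    fix s m assume "P m s"
    obtain s' where s': "P (Suc m) s'" using ex by blast
    have "P (Suc m) (min s' (s / 2))"
      using \<open>P m s\<close> s' by (intro smaller[OF s']) (auto simp: P_def)
    then show "\<exists>t. P (Suc m) t \<and> 2 * t \<le> s" by (intro exI[of _ "min s' (s / 2)"]) auto
  qed
  then obtain y where "\<And>m. P m (y m)" "\<And>m. 2 * y (Suc m) \<le> y m" by blast
  then show ?thesis using that unfolding P_def by (metis (no_types, lifting))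
qed

text \<open>The approximations \<open>\<phi> m\<close> are placed at heights \<open>y m\<close> decreasing so fast that \<open>\<phi> m\<close> is almost
  constant at the scale \<open>y m\<close>; interpolating between them gives a function with the prescribed
  nontangential boundary values.\<close>

lemma nontangential_extension:
  fixes n :: "real \<Rightarrow> int"
  assumes n: "\<And>k. fsigma_in euclidean {p. n p = k}"
  obtains h :: "complex \<Rightarrow> real" where "continuous_on upper_half h"
    "\<And>p c e. e > 0 \<Longrightarrow>
      \<exists>\<epsilon>>0. \<forall>z. 0 < Im z \<and> Im z < \<epsilon> \<and> \<bar>Re z - p\<bar> \<le> c * Im z \<longrightarrow> \<bar>h z - of_int (n p)\<bar> < e"
proof -
  obtain \<phi> :: "nat \<Rightarrow> real \<Rightarrow> real" where \<phi>: "\<And>m. continuous_on UNIV (\<phi> m)"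
    "\<And>p. \<exists>M. \<forall>m\<ge>M. \<phi> m p = of_int (n p)"
    by (rule eventually_exact_approximation[OF n], rule that)
  obtain y :: "nat \<Rightarrow> real" where y: "\<And>m. 0 < y m" "\<And>m. y m < 1 / Suc m" "\<And>m. 2 * y (Suc m) \<le> y m"
    "\<And>m p x k. \<lbrakk>\<bar>p\<bar> \<le> real m; \<bar>x - p\<bar> \<le> Suc m * y m; k \<in> {Suc m, Suc (Suc m)}\<rbrakk>
      \<Longrightarrow> \<bar>\<phi> k x - \<phi> k p\<bar> \<le> 1 / Suc m"
    by (rule scale_sequence[OF \<phi>(1)], rule that)
  have "y (Suc m) \<le> y m" for m using y(1)[of "Suc m"] y(3)[of m] by linarith
  then have "decseq y" by (rule decseq_SucI)
  then have y_mono: "y j \<le> y i" if "i \<le> j" for i j using that by (rule decseqD)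
  have small: "\<exists>N. y N < r" if "r > 0" for r
    using reals_Archimedean[OF that] y(2) by (auto simp: inverse_eq_divide intro: less_trans)
  \<comment> \<open>A piecewise linear cutoff: 1 up to height \<open>y m\<close>, 0 from
    \<open>2 * y m\<close> on. By the halving of the heights, transition zones of different indices
    overlap at most in their ends.\<close>
  define c where "c m s = max 0 (min 1 (2 - s / y m))" for m s
  have c1: "c m s = 1" if "s \<le> y m" for m s using that y(1)[of m] by (simp add: c_def)
  have c0: "c m s = 0" if "2 * y m \<le> s" for m s using that y(1)[of m] by (simp add: c_def field_simps)
  have c_bounds: "0 \<le> c m s" "c m s \<le> 1" for m s by (auto simp: c_def)
  \<comment> \<open>A telescoping sum with its terms switched on one after the other as the height
    decreases.\<close>
  define S where "S N z = \<phi> 0 (Re z) + (\<Sum>m<N. c m (Im z) * (\<phi> (Suc m) (Re z) - \<phi> m (Re z)))" for N z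
  have S_cont: "continuous_on UNIV (S N)" for N
    unfolding S_def c_def using y(1)
    by (intro continuous_intros continuous_on_compose2[OF \<phi>(1)]) (auto simp: less_imp_neq[symmetric])
  have S_stable: "S N' z = S N z" if "2 * y N \<le> Im z" "N \<le> N'" for N N' z
    using that(2)
  proof (induction rule: dec_induct)
    case (step j)
    have "c j (Im z) = 0" using that(1) y_mono[OF step(1)] by (intro c0) linarith
    then show ?case using step by (simp add: S_def)
  qed simp
  \<comment> \<open>Any \<open>N\<close> with \<open>2 * y N \<le> Im z\<close> gives the same
    value, as further terms vanish at that height; \<open>LEAST\<close> merely selects one. Near
    each point \<open>h\<close> thus agrees with a single \<open>S N\<close>.\<close>
  define h where "h z = S (LEAST N. 2 * y N \<le> Im z) z" for z
  have h_eq: "h z = S N z" if "2 * y N \<le> Im z" for N z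
  proof -
    have "2 * y (LEAST N. 2 * y N \<le> Im z) \<le> Im z" "(LEAST N. 2 * y N \<le> Im z) \<le> N"
      using that by (auto intro: LeastI Least_le)
    then show ?thesis unfolding h_def using S_stable by metis
  qed
  have "continuous_on upper_half h"
  proof (subst continuous_on_eq_continuous_at[OF open_halfspace_Im_gt], safe)
    fix z assume "Im z > 0"
    then obtain N where N: "y N < Im z / 2" using small[of "Im z / 2"] by auto
    have "\<forall>\<^sub>F w in nhds z. w \<in> {w. 2 * y N < Im w}"
      using N by (intro eventually_nhds_in_open open_halfspace_Im_gt) auto
    then have "\<forall>\<^sub>F w in nhds z. h w = S N w"
      by (rule eventually_mono) (auto intro: h_eq)
    then have "isCont h z \<longleftrightarrow> isCont (S N) z" by (rule isCont_cong)
    then show "isCont h z" using S_cont[of N] by (simp add: continuous_on_eq_continuous_at)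
  qed
  moreover have "\<exists>\<epsilon>>0. \<forall>z. 0 < Im z \<and> Im z < \<epsilon> \<and> \<bar>Re z - p\<bar> \<le> b * Im z \<longrightarrow> \<bar>h z - of_int (n p)\<bar> < e"
    if "e > 0" for p b e
  proof -
    obtain M1 where M1: "\<And>m. m \<ge> M1 \<Longrightarrow> \<phi> m p = of_int (n p)" using \<phi>(2) by blast
    obtain M2 where M2: "1 / Suc M2 < e" using reals_Archimedean[OF \<open>e > 0\<close>] by (auto simp: inverse_eq_divide)
    \<comment> \<open>From this index on the approximations are exact at \<open>p\<close>, the error
      bound is below \<open>e\<close>, the window contains \<open>p\<close>, and the controlled
      aperture exceeds \<open>b\<close>.\<close>
    define M0 where "M0 = M1 + M2 + nat \<lceil>\<bar>p\<bar>\<rceil> + nat \<lceil>b\<rceil>"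
    have M0: "M1 \<le> M0" "M2 \<le> M0" "\<bar>p\<bar> \<le> M0" "b \<le> M0"
      using real_nat_ceiling_ge[of "\<bar>p\<bar>"] real_nat_ceiling_ge[of b] unfolding M0_def by linarith+
    have "\<bar>h z - of_int (n p)\<bar> < e" if z: "0 < Im z" "Im z < y M0" "\<bar>Re z - p\<bar> \<le> b * Im z" for z
    proof -
      \<comment> \<open>The height of \<open>z\<close> lies in the band from \<open>y K\<close>,
        exclusive, to the preceding scale, inclusive; a height below \<open>y M0\<close> forces
        \<open>K\<close> beyond \<open>M0\<close>.\<close>
      define K where "K = (LEAST N. y N < Im z)"
      have K: "y K < Im z" unfolding K_def using small[OF z(1)] by (rule LeastI_ex)
      have "M0 < K" using K z(2) y_mono[of K M0] by (cases "M0 < K") auto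
      then obtain M where M: "K = Suc M" "M0 \<le> M" by (cases K) auto
      have yM: "Im z \<le> y M" using not_less_Least[of M "\<lambda>N. y N < Im z"] M(1) by (simp add: K_def)
      let ?x = "Re z"
      \<comment> \<open>All cutoffs up to index \<open>M\<close> equal 1 at this height, so these
        terms telescope and only the one of index \<open>Suc M\<close> keeps a weight.\<close>
      have "(\<Sum>m<Suc M. c m (Im z) * (\<phi> (Suc m) ?x - \<phi> m ?x)) = (\<Sum>m<Suc M. \<phi> (Suc m) ?x - \<phi> m ?x)"
      proof (intro sum.cong refl)
        fix m assume "m \<in> {..<Suc M}"
        then have "Im z \<le> y m" using yM y_mono[of m M] by auto
        then show "c m (Im z) * (\<phi> (Suc m) ?x - \<phi> m ?x) = \<phi> (Suc m) ?x - \<phi> m ?x" by (simp add: c1)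
      qed
      also have "\<dots> = \<phi> (Suc M) ?x - \<phi> 0 ?x" by (rule sum_lessThan_telescope)
      finally have "S (Suc (Suc M)) z = \<phi> (Suc M) ?x + c (Suc M) (Im z) * (\<phi> (Suc (Suc M)) ?x - \<phi> (Suc M) ?x)"
        by (simp add: S_def)
      moreover have "h z = S (Suc (Suc M)) z"
        using K y(3)[of "Suc M"] M(1) by (intro h_eq) auto
      \<comment> \<open>Since \<open>c\<close> lies between 0 and 1, the deviation of
        \<open>h z\<close> is a convex combination of the deviations of two neighbouring
        approximations.\<close>
      ultimately have hz: "h z - of_int (n p) =
          (1 - c (Suc M) (Im z)) * (\<phi> (Suc M) ?x - of_int (n p))
          + c (Suc M) (Im z) * (\<phi> (Suc (Suc M)) ?x - of_int (n p))"
        by (simp add: algebra_simps)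
      have "\<bar>p\<bar> \<le> M" "b \<le> Suc M" using M0 M(2) by linarith+
      moreover have "\<bar>?x - p\<bar> \<le> Suc M * y M"
      proof -
        have "b * Im z \<le> Suc M * Im z" using \<open>b \<le> Suc M\<close> z(1) by (intro mult_right_mono) auto
        also have "\<dots> \<le> Suc M * y M" using yM by (intro mult_left_mono) auto
        finally show ?thesis using z(3) by linarith
      qed
      ultimately have est: "\<bar>\<phi> k ?x - of_int (n p)\<bar> \<le> 1 / Suc M" if "k \<in> {Suc M, Suc (Suc M)}" for k
        using y(4)[of p M ?x k] M1[of k] that M0(1) M(2) by auto
      have "\<bar>h z - of_int (n p)\<bar> \<le> (1 - c (Suc M) (Im z)) * (1 / Suc M) + c (Suc M) (Im z) * (1 / Suc M)"
      proof -
        have "\<bar>r * (\<phi> k ?x - of_int (n p))\<bar> \<le> r * (1 / Suc M)" if "0 \<le> r" "k \<in> {Suc M, Suc (Suc M)}" for k r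
          unfolding abs_mult abs_of_nonneg[OF that(1)] using est that by (intro mult_left_mono) auto
        then show ?thesis
          unfolding hz using c_bounds[of "Suc M" "Im z"]
          by (intro order_trans[OF abs_triangle_ineq] add_mono) auto
      qed
      also have "\<dots> = 1 / Suc M" by (simp add: algebra_simps)
      also have "\<dots> \<le> 1 / Suc M2" using M0(2) M(2) by (intro divide_left_mono) auto
      finally show ?thesis using M2 by linarith
    qed
    then show ?thesis using y(1)[of M0] by blast
  qed
  ultimately show ?thesis by (rule that)
qed

section \<open>Circle-valued maps with prescribed jumps across the boundary lines\<close>

lemma sin_ge_of_between:
  assumes "0 < a" "a \<le> x" "x \<le> pi - a"
  shows "sin a \<le> sin x"
proof (cases "x \<le> pi / 2")
  case True
  then show ?thesis using assms by (intro sin_monotone_2pi_le) auto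
next
  case False
  then have "sin a \<le> sin (pi - x)" using assms by (intro sin_monotone_2pi_le) auto
  then show ?thesis by simp
qed

text \<open>The map is \<open>cis (2 * pi * f z)\<close> on the first copy and 1 on the second,
  where \<open>f\<close> has nontangential limits \<open>n p\<close>. These are integers, so both
  copies give the value 1 on every ray and the maps glue.\<close>

lemma lift_pair_of_fsigma:
  fixes n :: "real \<Rightarrow> int"
  assumes n: "\<And>k. fsigma_in euclidean {p. n p = k}"
  obtains g h where "continuous_map prufer circle g" "lift_pair g h n"
proof -
  obtain f :: "complex \<Rightarrow> real" where f: "continuous_on upper_half f"
    "\<And>p c e. e > 0 \<Longrightarrow>
      \<exists>\<epsilon>>0. \<forall>z. 0 < Im z \<and> Im z < \<epsilon> \<and> \<bar>Re z - p\<bar> \<le> c * Im z \<longrightarrow> \<bar>f z - of_int (n p)\<bar> < e"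
    by (rule nontangential_extension[OF n], rule that)
  define k where "k x = 2 * pi * (case x of Pt z \<Rightarrow> f z | Ray p \<theta> \<Rightarrow> of_int (n p))" for x
  have k: "continuous_map bordered_prufer euclideanreal k"
    unfolding continuous_map_bordered_iff
  proof (intro conjI allI impI)
    show "continuous_on upper_half (k \<circ> Pt)"
      using f(1) by (auto simp: k_def o_def intro!: continuous_intros)
    fix p \<theta> e :: real assume a: "0 < \<theta> \<and> \<theta> < pi \<and> e > 0"
    \<comment> \<open>Half the angular distance of the ray from the real axis: directions within
      \<open>a\<close> of \<open>\<theta>\<close> stay between \<open>a\<close> and
      \<open>pi - a\<close>. Their sine is at least \<open>sin a\<close>, which places
      \<open>z\<close> in the cone with constant \<open>1 / sin a\<close>.\<close>
    define a where "a = min \<theta> (pi - \<theta>) / 2"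
    have a_pos: "0 < a" "2 * a \<le> \<theta>" "\<theta> \<le> pi - 2 * a" using a by (auto simp: a_def)
    then have "sin a > 0" using a by (intro sin_gt_zero) auto
    have "e / (2 * pi) > 0" using a by simp
    then obtain \<epsilon> where \<epsilon>: "\<epsilon> > 0"
      "\<And>z. \<lbrakk>0 < Im z; Im z < \<epsilon>; \<bar>Re z - p\<bar> \<le> (1 / sin a) * Im z\<rbrakk> \<Longrightarrow> \<bar>f z - of_int (n p)\<bar> < e / (2 * pi)"
      using f(2) by metis
    have "dist (k x) (k (Ray p \<theta>)) < e" if x: "x \<in> ray_nhd p \<theta> (min a \<epsilon>)" for x
    proof (cases x)
      case (Ray q \<phi>)
      then show ?thesis using x a by (simp add: Ray_mem_ray_nhd k_def)
    next
      case (Pt z)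
      let ?w = "z - of_real p"
      have z: "Im z > 0" "cmod ?w < \<epsilon>" "\<bar>Arg ?w - \<theta>\<bar> < a"
        using x Pt by (auto simp: Pt_mem_ray_nhd)
      then have "sin a \<le> sin (Arg ?w)" using a_pos by (intro sin_ge_of_between) linarith+
      then have "cmod ?w * sin a \<le> cmod ?w * sin (Arg ?w)" by (intro mult_left_mono) auto
      also have "\<dots> = Im z" using rcis_cmod_Arg[of ?w] by (metis Im_rcis Im_complex_of_real diff_zero minus_complex.sel(2))
      finally have "cmod ?w \<le> (1 / sin a) * Im z" using \<open>sin a > 0\<close> by (simp add: field_simps)
      moreover have "\<bar>Re z - p\<bar> \<le> cmod ?w" using abs_Re_le_cmod[of ?w] by simp
      moreover have "Im z \<le> cmod ?w" using abs_Im_le_cmod[of ?w] by simp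
      ultimately have "\<bar>f z - of_int (n p)\<bar> < e / (2 * pi)" using z by (intro \<epsilon>(2)) linarith+
      moreover have "dist (k x) (k (Ray p \<theta>)) = 2 * pi * \<bar>f z - of_int (n p)\<bar>"
        by (simp add: Pt k_def dist_real_def abs_mult flip: right_diff_distrib)
      ultimately show ?thesis by (simp add: field_simps)
    qed
    then show "\<exists>\<epsilon>>0. \<forall>x\<in>ray_nhd p \<theta> \<epsilon>. dist (k x) (k (Ray p \<theta>)) < e"
      using \<epsilon>(1) a_pos(1) by (intro exI[of _ "min a \<epsilon>"]) auto
  qed
  define h where "h b = (if b then (\<lambda>_. 0) else k)" for b :: bool
  define g where "g y = cis (h (snd y) (fst y))" for y
  have h: "continuous_map bordered_prufer euclideanreal (h b)" for b
    using k by (simp add: h_def)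
  have boundary: "cis (h b x) = 1" if "x \<in> boundary_rays" for b x
    using that cis_add_2pi[of 0] by (auto simp: boundary_rays_def h_def k_def)
  have "continuous_map prufer circle g"
    unfolding g_def
    by (rule continuous_map_prufer_glued[where h="\<lambda>b x. cis (h b x)"]) (auto simp: boundary intro: continuous_map_cis h)
  moreover have "lift_pair g h n"
    unfolding lift_pair_def
  proof (intro conjI allI impI ballI)
    show "g (glue boundary_rays b x) = cis (h b x)" for b x
      using boundary[of x] by (cases "x \<in> boundary_rays") (auto simp: g_def glue_def)
  qed (simp_all add: h, simp add: h_def k_def)
  ultimately show ?thesis using that by blast
qed

theorem theoremA:
  "comparison prufer prufer_base
     \<in> mon (cohomotopy_group prufer) (Hom_group pi1_prufer integer_group) \<and>
   on_generators \<circ> comparison prufer prufer_base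
     \<in> mon (cohomotopy_group prufer) int_functions \<and>
   (on_generators \<circ> comparison prufer prufer_base) ` carrier (cohomotopy_group prufer) =
     {f \<in> carrier int_functions. baire1 (top_of_set nonzero_reals) (discrete_topology UNIV) f}"
proof -
  let ?comp = "comparison prufer prufer_base"
  let ?G = "cohomotopy_group prufer"
  have carrierE: "\<exists>f. continuous_map prufer circle f \<and> a = map_class prufer f" if "a \<in> carrier ?G" for a
    using that by (auto simp: cohomotopy_group_def)
  have gen_value: "(on_generators \<circ> ?comp) (map_class prufer f) = (\<lambda>t\<in>nonzero_reals. circle_degree (f \<circ> alpha t))"
    if "continuous_map prufer circle f" for f
    using comparison_class[OF that alpha_loop] by (auto simp: on_generators_def)
  have inj: "inj_on (on_generators \<circ> ?comp) (carrier ?G)"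
  proof (rule inj_onI)
    fix a b assume "a \<in> carrier ?G" "b \<in> carrier ?G" and eq: "(on_generators \<circ> ?comp) a = (on_generators \<circ> ?comp) b"
    then obtain f g where f: "continuous_map prufer circle f" "a = map_class prufer f"
      and g: "continuous_map prufer circle g" "b = map_class prufer g"
      using carrierE by meson
    have "circle_degree (f \<circ> alpha t) = circle_degree (g \<circ> alpha t)" if "t \<noteq> 0" for t
      using fun_cong[OF eq, of t] that unfolding f(2) g(2) gen_value[OF f(1)] gen_value[OF g(1)] by simp
    then have "homotopic_with (\<lambda>_. True) prufer circle g f"
      by (rule homotopic_of_equal_degrees[OF f(1) g(1)])
    then have "f \<in> map_class prufer g" by (simp add: map_class_def)
    then show "a = b" unfolding f(2) g(2) by (rule map_class_eq)
  qed
  \<comment> \<open>If the values on the generators already separate classes, then so do the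
    homomorphisms themselves.\<close>
  have "inj_on ?comp (carrier ?G)" using inj by (rule inj_on_imageI2)
  then have comp: "?comp \<in> mon ?G (Hom_group pi1_prufer integer_group)"
    using comparison_hom by (simp add: mon_def)
  have "on_generators \<circ> ?comp \<in> hom ?G int_functions"
  proof (rule homI)
    fix a assume "a \<in> carrier ?G"
    then show "(on_generators \<circ> ?comp) a \<in> carrier int_functions"
      by (auto simp: on_generators_def)
  next
    fix a b assume "a \<in> carrier ?G" "b \<in> carrier ?G"
    then obtain f g where f: "continuous_map prufer circle f" "a = map_class prufer f"
      and g: "continuous_map prufer circle g" "b = map_class prufer g"
      using carrierE by meson
    have "?comp (a \<otimes>\<^bsub>?G\<^esub> b) (path_class prufer (alpha t))
        = ?comp a (path_class prufer (alpha t)) + ?comp b (path_class prufer (alpha t))" if "t \<noteq> 0" for t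
      unfolding f(2) g(2) using alpha_loop[OF that]
      by (intro comparison_mult[OF f(1) g(1)]) (auto simp: fundamental_group_def)
    then show "(on_generators \<circ> ?comp) (a \<otimes>\<^bsub>?G\<^esub> b)
        = (on_generators \<circ> ?comp) a \<otimes>\<^bsub>int_functions\<^esub> (on_generators \<circ> ?comp) b"
      by (auto simp: on_generators_def product_group_def)
  qed
  with inj have gen: "on_generators \<circ> ?comp \<in> mon ?G int_functions" by (simp add: mon_def)
  let ?B = "{f \<in> carrier int_functions. baire1 (top_of_set nonzero_reals) (discrete_topology UNIV) f}"
  have "(on_generators \<circ> ?comp) ` carrier ?G \<subseteq> ?B"
  proof
    fix u assume "u \<in> (on_generators \<circ> ?comp) ` carrier ?G"
    then obtain g where g: "continuous_map prufer circle g" "u = (on_generators \<circ> ?comp) (map_class prufer g)"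
      using carrierE by blast
    obtain h n where hn: "lift_pair g h n" using lift_pair_exists[OF g(1)] .
    have u: "u = (\<lambda>t\<in>nonzero_reals. n t - n 0)"
      unfolding g(2) gen_value[OF g(1)] using circle_degree_alpha[OF hn] by auto
    have "{t \<in> nonzero_reals. u t = k} = {t. n t = k + n 0} \<inter> nonzero_reals" for k
      by (auto simp: u)
    then have "baire1 (top_of_set nonzero_reals) (discrete_topology UNIV) u"
      using lift_pair_fsigma[OF hn]
      by (auto simp: baire1_discrete_iff fsigma_in_subtopology)
    then show "u \<in> ?B" by (auto simp: u)
  qed
  moreover have "?B \<subseteq> (on_generators \<circ> ?comp) ` carrier ?G"
  proof
    fix u assume u: "u \<in> ?B"
    \<comment> \<open>The value 0 at the base line normalises the jumps, so that
      \<open>n t - n 0\<close> is \<open>u t\<close>.\<close>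
    define n where "n t = (if t = 0 then 0 else u t)" for t
    have n: "fsigma_in euclidean {p. n p = k}" for k
    proof -
      have "fsigma_in (top_of_set nonzero_reals) {t \<in> nonzero_reals. u t = k}"
        using u by (simp add: baire1_discrete_iff)
      then obtain T where T: "fsigma_in euclidean T" "{t \<in> nonzero_reals. u t = k} = T \<inter> nonzero_reals"
        unfolding fsigma_in_subtopology by blast
      \<comment> \<open>An open subset of a metrizable space is F_sigma, so F_sigma sets of the
        punctured line are F_sigma in the whole line. The added point 0 enlarges the fibre over 0 by
        a closed set.\<close>
      have "fsigma_in euclidean (T \<inter> nonzero_reals)"
        by (intro fsigma_in_Int T(1) open_imp_fsigma_in) (auto simp: metrizable_space_euclidean)
      moreover have "fsigma_in euclidean (if k = 0 then {0::real} else {})"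
        by (auto intro: closed_imp_fsigma_in)
      moreover have "{p. n p = k} = (T \<inter> nonzero_reals) \<union> (if k = 0 then {0} else {})"
        unfolding T(2)[symmetric] by (auto simp: n_def)
      ultimately show ?thesis by (simp only: fsigma_in_Un)
    qed
    obtain g h where g: "continuous_map prufer circle g" and hn: "lift_pair g h n"
      using lift_pair_of_fsigma[OF n] by blast
    have "(on_generators \<circ> ?comp) (map_class prufer g) = u"
    proof
      fix t show "(on_generators \<circ> ?comp) (map_class prufer g) t = u t"
        unfolding gen_value[OF g] using circle_degree_alpha[OF hn, of t] u
        by (cases "t = 0") (auto simp: n_def PiE_def extensional_def)
    qed
    moreover have "map_class prufer g \<in> carrier ?G" using g by (auto simp: cohomotopy_group_def)
    ultimately show "u \<in> (on_generators \<circ> ?comp) ` carrier ?G" by (metis image_eqI)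
  qed
  ultimately show ?thesis using comp gen by blast
qed

end
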